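(* Let $n\ge3$. Assume that $g$ is a real-valued continuous function on $(\mathbb S^n\setminus\{\mathbf n\})\times(0,\infty)$ with $g(\cdot,s)$ bounded from below in $\mathbb S^n\setminus\{\mathbf n\}$ for each $s\in(0,\infty)$, and that: (1) for each $s>0$ the function $\theta\mapsto g(\theta,s)$ is rotationally symmetric about the line through $\mathbf n$ and $\mathbf s$; (2) for each $s>0$ and any $\theta,\theta'$ on the same geodesic passing through $\mathbf n$ and $\mathbf s$, $g(\theta,s)>g(\theta',s)$ if $\theta_{n+1}>\theta'_{n+1}$; (3) for each $\theta\in\mathbb S^n\setminus\{\mathbf n,\mathbf s\}$ the function $s\mapsto s^{-(n+2)/(n-2)}g(\theta,s)$ is non-increasing on $(0,\infty)$; (4) for each $\theta\in\mathbb S^n\setminus\{\mathbf n,\mathbf s\}$ the function $s\mapsto g(\theta,s)$ is non-decreasing on $(0,\infty)$. If $v\in C^2(\mathbb S^n\setminus\{\mathbf n\})$ is a solution of $$-\mathcal L_{\mathbb S^n}v=g(\theta,v)\quad\text{and}\quad v>0\quad\text{on }\mathbb S^n\setminus\{\mathbf n\}$$ satisfying $\liminf_{\theta\to\mathbf n}v(\theta)>0$, then $v$ is rotationally symmetric about the line through $\mathbf n$ and $\mathbf s$.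
   Context: $\mathbb S^n\subset\mathbb R^{n+1}$ is the unit sphere with its standard metric, points written $\theta=(\theta_1,\dots,\theta_{n+1})$; $\mathbf n=(0,\dots,0,1)$ and $\mathbf s=(0,\dots,0,-1)$ are the north and south poles. The conformal Laplacian is $\mathcal L_{\mathbb S^n}:=\Delta_{\mathbb S^n}-\frac{n(n-2)}4$, with $\Delta_{\mathbb S^n}$ the Laplace–Beltrami operator. *)

theory Defs
  imports "HOL-Analysis.Analysis"
begin

text \<open>
  \<open>\<real>\<^sup>n\<^sup>+\<^sup>1\<close> is \<open>(real ^ 'n) \<times> real\<close> with \<open>n = CARD('n)\<close>: a point \<open>(\<theta>\<^sub>1, \<dots>, \<theta>\<^sub>n\<^sub>+\<^sub>1)\<close> is the pair
  of \<open>(\<theta>\<^sub>1, \<dots>, \<theta>\<^sub>n)\<close> and \<open>\<theta>\<^sub>n\<^sub>+\<^sub>1\<close>, and the product inner product is the Euclidean one.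
\<close>

abbreviation unit_sphere :: "((real ^ 'n) \<times> real) set" where
  "unit_sphere \<equiv> sphere 0 1"

definition north_pole :: "(real ^ 'n) \<times> real" where
  "north_pole = (0, 1)"

definition south_pole :: "(real ^ 'n) \<times> real" where
  "south_pole = (0, -1)"

text \<open>
  The rotations of \<open>\<real>\<^sup>n\<^sup>+\<^sup>1\<close> that fix the line through the poles pointwise are the maps
  \<open>(y, t) \<mapsto> (A y, t)\<close> with \<open>A \<in> SO(n)\<close>.
\<close>

definition rot_symmetric_on ::
    "((real ^ 'n) \<times> real) set \<Rightarrow> ((real ^ 'n) \<times> real \<Rightarrow> 'b) \<Rightarrow> bool" where
  "rot_symmetric_on D f \<longleftrightarrow>
     (\<forall>A. rotation_matrix A \<longrightarrow> (\<forall>y t. (y, t) \<in> D \<longrightarrow> f (A *v y, t) = f (y, t)))"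

text \<open>The great circle through both poles and through \<open>(w, 0)\<close>, for a unit vector \<open>w\<close>.\<close>

definition polar_geodesic :: "real ^ 'n \<Rightarrow> ((real ^ 'n) \<times> real) set" where
  "polar_geodesic w = range (\<lambda>t. (sin t *\<^sub>R w, cos t))"

definition partial_deriv ::
    "'n \<Rightarrow> (real ^ 'n \<Rightarrow> 'b::real_normed_vector) \<Rightarrow> real ^ 'n \<Rightarrow> 'b" where
  "partial_deriv i f x = vector_derivative (\<lambda>t. f (x + t *\<^sub>R axis i 1)) (at 0)"

text \<open>
  The matrix \<open>(g\<^sub>i\<^sub>j)\<close>, in the coordinates of a local parametrization \<open>\<phi>\<close> of a submanifold of a
  Euclidean space, of the metric induced by the ambient inner product.
\<close>

definition induced_metric :: "(real ^ 'n \<Rightarrow> 'b::real_inner) \<Rightarrow> real ^ 'n \<Rightarrow> real ^ 'n ^ 'n" where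
  "induced_metric \<phi> x = (\<chi> i j. partial_deriv i \<phi> x \<bullet> partial_deriv j \<phi> x)"

text \<open>
  The Laplace--Beltrami operator of a Riemannian metric \<open>G = (g\<^sub>i\<^sub>j)\<close> in coordinates,
  \<open>div\<^sub>G grad\<^sub>G u = det(G)\<^sup>-\<^sup>1\<^sup>/\<^sup>2 \<Sum>\<^sub>i \<partial>\<^sub>i (det(G)\<^sup>1\<^sup>/\<^sup>2 \<Sum>\<^sub>j g\<^sup>i\<^sup>j \<partial>\<^sub>j u)\<close>.
\<close>

definition laplace_beltrami_coord ::
    "(real ^ 'n \<Rightarrow> real ^ 'n ^ 'n) \<Rightarrow> (real ^ 'n \<Rightarrow> real) \<Rightarrow> real ^ 'n \<Rightarrow> real" where
  "laplace_beltrami_coord G u x =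
     (1 / sqrt (det (G x))) *
     (\<Sum>i\<in>UNIV. partial_deriv i
        (\<lambda>y. sqrt (det (G y)) * (\<Sum>j\<in>UNIV. matrix_inv (G y) $ i $ j * partial_deriv j u y)) x)"

text \<open>
  Stereographic projection from the north pole is a global chart of the sphere minus the
  north pole; differentiability and differential operators on that manifold are read off
  in this chart, on which they do not depend.
\<close>

definition stereographic :: "(real ^ 'n) \<times> real \<Rightarrow> real ^ 'n" where
  "stereographic \<theta> = (1 / (1 - snd \<theta>)) *\<^sub>R fst \<theta>"

definition inv_stereographic :: "real ^ 'n \<Rightarrow> (real ^ 'n) \<times> real" where
  "inv_stereographic x =
     ((2 / ((norm x)\<^sup>2 + 1)) *\<^sub>R x, ((norm x)\<^sup>2 - 1) / ((norm x)\<^sup>2 + 1))"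

definition laplacian_sphere ::
    "((real ^ 'n) \<times> real \<Rightarrow> real) \<Rightarrow> (real ^ 'n) \<times> real \<Rightarrow> real" where
  "laplacian_sphere v \<theta> =
     laplace_beltrami_coord (induced_metric inv_stereographic) (v \<circ> inv_stereographic)
       (stereographic \<theta>)"

definition conformal_laplacian_sphere ::
    "((real ^ 'n) \<times> real \<Rightarrow> real) \<Rightarrow> (real ^ 'n) \<times> real \<Rightarrow> real" where
  "conformal_laplacian_sphere v \<theta> =
     laplacian_sphere v \<theta> - real CARD('n) * (real CARD('n) - 2) / 4 * v \<theta>"

text \<open>For open \<open>S\<close>.\<close>

definition C2_on :: "'a::real_normed_vector set \<Rightarrow> ('a \<Rightarrow> 'b::real_normed_vector) \<Rightarrow> bool" where
  "C2_on S f \<longleftrightarrow>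
     (\<exists>(f' :: 'a \<Rightarrow> 'a \<Rightarrow>\<^sub>L 'b) (f'' :: 'a \<Rightarrow> 'a \<Rightarrow>\<^sub>L 'a \<Rightarrow>\<^sub>L 'b).
        (\<forall>x\<in>S. (f has_derivative blinfun_apply (f' x)) (at x)) \<and>
        (\<forall>x\<in>S. (f' has_derivative blinfun_apply (f'' x)) (at x)) \<and>
        continuous_on S f'')"

definition C2_punctured_sphere :: "((real ^ 'n) \<times> real \<Rightarrow> real) \<Rightarrow> bool" where
  "C2_punctured_sphere v \<longleftrightarrow> C2_on UNIV (v \<circ> inv_stereographic)"

lemma inv_stereographic_bij:
  "bij_betw inv_stereographic UNIV (unit_sphere - {north_pole :: (real ^ 'n) \<times> real})"
proof (rule bij_betw_byWitness[where f' = stereographic])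
  have pos: "(norm x)\<^sup>2 + 1 > 0" for x :: "real ^ 'n"
    by (simp add: add_nonneg_pos)
  have pos': "(norm x)\<^sup>2 + 1 \<noteq> 0" for x :: "real ^ 'n"
    using pos[of x] by simp
  show "\<forall>x\<in>UNIV. stereographic (inv_stereographic x) = (x :: real ^ 'n)"
  proof
    fix x :: "real ^ 'n"
    have "1 - ((norm x)\<^sup>2 - 1) / ((norm x)\<^sup>2 + 1) = 2 / ((norm x)\<^sup>2 + 1)"
      using pos'[of x] by (simp add: divide_simps)
    then have "1 / (1 - ((norm x)\<^sup>2 - 1) / ((norm x)\<^sup>2 + 1)) * (2 / ((norm x)\<^sup>2 + 1)) = 1"
      using pos'[of x] by (simp only:) simp
    then show "stereographic (inv_stereographic x) = x"
      by (simp only: stereographic_def inv_stereographic_def fst_conv snd_conv scaleR_scaleR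
          scaleR_one)
  qed
  show "\<forall>\<theta>\<in>unit_sphere - {north_pole}. inv_stereographic (stereographic \<theta>) = (\<theta> :: (real ^ 'n) \<times> real)"
  proof
    fix \<theta> :: "(real ^ 'n) \<times> real" assume a: "\<theta> \<in> unit_sphere - {north_pole}"
    obtain y t where \<theta>: "\<theta> = (y, t)" by force
    have n: "(norm y)\<^sup>2 + t\<^sup>2 = 1"
      using a by (simp add: \<theta> norm_Pair real_sqrt_eq_1_iff)
    have t: "t \<noteq> 1"
      using a n by (auto simp: \<theta> north_pole_def)
    have "(norm y)\<^sup>2 = (1 - t) * (1 + t)"
      using n by (simp add: algebra_simps power2_eq_square)
    then have e: "(norm ((1 / (1 - t)) *\<^sub>R y))\<^sup>2 = (1 + t) / (1 - t)"
      using t by (simp add: power_divide power2_eq_square divide_simps)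
    have "(1 + t) / (1 - t) + 1 = 2 / (1 - t)" "(1 + t) / (1 - t) - 1 = 2 * t / (1 - t)"
      using t by (simp_all add: divide_simps)
    then show "inv_stereographic (stereographic \<theta>) = \<theta>"
      using t unfolding \<theta> stereographic_def inv_stereographic_def fst_conv snd_conv e
      by simp
  qed
  show "inv_stereographic ` UNIV \<subseteq> unit_sphere - {north_pole :: (real ^ 'n) \<times> real}"
  proof
    fix \<theta> :: "(real ^ 'n) \<times> real" assume "\<theta> \<in> inv_stereographic ` UNIV"
    then obtain x where \<theta>: "\<theta> = inv_stereographic x" by blast
    have "(2 / ((norm x)\<^sup>2 + 1) * norm x)\<^sup>2 + (((norm x)\<^sup>2 - 1) / ((norm x)\<^sup>2 + 1))\<^sup>2 = 1"
      using pos'[of x] by (simp add: divide_simps) (simp add: algebra_simps power2_eq_square)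
    then have "norm \<theta> = 1"
      using pos[of x] by (simp add: \<theta> inv_stereographic_def norm_Pair power_divide)
    moreover have "((norm x)\<^sup>2 - 1) / ((norm x)\<^sup>2 + 1) \<noteq> 1"
      using pos'[of x] by (simp add: divide_simps)
    then have "\<theta> \<noteq> north_pole"
      by (simp add: \<theta> inv_stereographic_def north_pole_def)
    ultimately show "\<theta> \<in> unit_sphere - {north_pole}" by simp
  qed
qed simp

end

theory Submission
  imports Defs
begin

text \<open>
  Stereographic projection from \<open>\<^bold>n\<close> turns the problem into one on \<open>\<real>\<^sup>n\<close>: the singular pole goes to
  infinity and \<open>\<^bold>s\<close> to the origin. With \<open>\<phi>(x) = 2 / (1 + |x|\<^sup>2)\<close>, \<open>a = (n - 2) / 2\<close> and \<open>\<theta>(x)\<close> the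
  point of the sphere over \<open>x\<close>, the conformal Laplacian of \<open>v\<close> is \<open>\<phi>\<close> to the power \<open>-(a + 2)\<close> times
  the flat Laplacian of \<open>u = \<phi>\<^sup>a v(\<theta>)\<close>, and hence \<open>-\<Delta> u = \<phi>\<^sup>a\<^sup>+\<^sup>2 g(\<theta>, \<phi>\<^sup>-\<^sup>a u)\<close>. The claim becomes
  that \<open>u\<close> is radial.

  This is proved by moving spheres, in the family of all spheres that pass through the origin.
  For a unit vector \<open>e\<close> and \<open>r > 0\<close>, compare \<open>u\<close> outside the ball of radius \<open>r\<close> about \<open>c = r e\<close>
  with its Kelvin transform \<open>u\<^sub>r\<close> in that ball. The inversion sends an outer point \<open>y\<close> to an inner
  point \<open>z\<close> with \<open>|z| = r |y| / |y - c| < |y|\<close>, so \<open>\<theta>(z)\<close> lies strictly lower than \<open>\<theta>(y)\<close>, and it is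
  contracting for the metric of the sphere. The first fact meets the strict monotonicity of \<open>g\<close> in
  height, the second the monotonicity of \<open>s \<mapsto> g(\<theta>, s) / s\<^sup>p\<close> with \<open>p = (n + 2) / (n - 2)\<close>;
  together they give \<open>-\<Delta> u\<^sub>r < \<phi>\<^sup>a\<^sup>+\<^sup>2 g(\<theta>, \<phi>\<^sup>-\<^sup>a u\<^sub>r)\<close>. As \<open>g\<close> is also non-decreasing in \<open>s\<close>, the
  gap \<open>u - u\<^sub>r\<close> is strictly superharmonic wherever it is nonnegative. This sign structure keeps
  the maximum principle elementary: once \<open>u \<ge> u\<^sub>r\<close> is known, the gap is positive outside the ball,
  has nonzero normal derivative on its boundary, and is at least a positive multiple of
  \<open>|y - c|\<^sup>2\<^sup>-\<^sup>n\<close> near infinity.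

  For small \<open>r\<close> the inequality \<open>u \<ge> u\<^sub>r\<close> follows from the regularity of \<open>u\<close> near the origin and
  from the positive lower limit of \<open>v\<close> at \<open>\<^bold>n\<close> (\<open>dominates_small\<close>); the set of good radii is closed
  by continuity and open by the three properties just listed (\<open>dominates_eventually_right\<close>). So
  \<open>u \<ge> u\<^sub>r\<close> for all \<open>r\<close>, and as \<open>r \<rightarrow> \<infinity>\<close> the sphere becomes a hyperplane through the origin: \<open>u\<close>
  dominates its reflection (\<open>reflection_le\<close>). Any two points of equal norm are exchanged by such a
  reflection, in both directions.
\<close>

section \<open>Divergence, Laplacian and the minimum principle\<close>

definition has_divergence :: "('a::euclidean_space \<Rightarrow> 'a) \<Rightarrow> real \<Rightarrow> 'a \<Rightarrow> bool" where
  "has_divergence F l x \<longleftrightarrow> (\<exists>L. (F has_derivative L) (at x) \<and> (\<Sum>b\<in>Basis. L b \<bullet> b) = l)"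

text \<open>
  The Laplacian is carried as the divergence of an explicit gradient field. Product and chain
  rules for it then reduce to those for \<open>has_derivative\<close>, and the gradient is at hand for
  boundary-point arguments.
\<close>

definition has_laplacian_on ::
    "('a::euclidean_space \<Rightarrow> real) \<Rightarrow> ('a \<Rightarrow> 'a) \<Rightarrow> ('a \<Rightarrow> real) \<Rightarrow> 'a set \<Rightarrow> bool" where
  "has_laplacian_on u G \<Delta> S \<longleftrightarrow>
     (\<forall>x\<in>S. (u has_derivative (\<lambda>h. G x \<bullet> h)) (at x) \<and> has_divergence G (\<Delta> x) x)"

lemma linear_sum_inner_Basis:
  fixes P :: "'a::euclidean_space \<Rightarrow> real"
  assumes "linear P"
  shows "(\<Sum>b\<in>Basis. P b * (w \<bullet> b)) = P w"
proof -
  have "P w = P (\<Sum>b\<in>Basis. (w \<bullet> b) *\<^sub>R b)"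
    by (simp add: euclidean_representation)
  also have "\<dots> = (\<Sum>b\<in>Basis. P b * (w \<bullet> b))"
    by (simp add: linear_sum[OF assms] linear_cmul[OF assms] mult.commute)
  finally show ?thesis ..
qed

lemma has_divergence_scaleR:
  assumes "(p has_derivative P) (at x)" and "has_divergence F l x"
  shows "has_divergence (\<lambda>y. p y *\<^sub>R F y) (p x * l + P (F x)) x"
proof -
  obtain L where L: "(F has_derivative L) (at x)" "(\<Sum>b\<in>Basis. L b \<bullet> b) = l"
    using assms(2) by (auto simp: has_divergence_def)
  have P: "linear P"
    using assms(1) has_derivative_linear by blast
  have "((\<lambda>y. p y *\<^sub>R F y) has_derivative (\<lambda>h. p x *\<^sub>R L h + P h *\<^sub>R F x)) (at x)"
    by (rule has_derivative_scaleR[OF assms(1) L(1)])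
  moreover have "(\<Sum>b\<in>Basis. (p x *\<^sub>R L b + P b *\<^sub>R F x) \<bullet> b) = p x * l + P (F x)"
    by (simp add: inner_add_left sum.distrib L(2)[symmetric] sum_distrib_left[symmetric]
        linear_sum_inner_Basis[OF P])
  ultimately show ?thesis
    unfolding has_divergence_def by blast
qed

lemma has_divergence_diff:
  assumes "has_divergence F l x" and "has_divergence E k x"
  shows "has_divergence (\<lambda>y. F y - E y) (l - k) x"
proof -
  obtain L K where L: "(F has_derivative L) (at x)" "(\<Sum>b\<in>Basis. L b \<bullet> b) = l"
    and K: "(E has_derivative K) (at x)" "(\<Sum>b\<in>Basis. K b \<bullet> b) = k"
    using assms by (auto simp: has_divergence_def)
  have "((\<lambda>y. F y - E y) has_derivative (\<lambda>h. L h - K h)) (at x)"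
    by (rule has_derivative_diff[OF L(1) K(1)])
  moreover have "(\<Sum>b\<in>Basis. (L b - K b) \<bullet> b) = l - k"
    by (simp add: inner_diff_left sum_subtractf L K)
  ultimately show ?thesis
    unfolding has_divergence_def by blast
qed

lemma has_divergence_position:
  "has_divergence (\<lambda>y. y - c) (real DIM('a)) (x :: 'a::euclidean_space)"
proof -
  have "((\<lambda>y. y - c) has_derivative (\<lambda>h. h)) (at x)"
    by (auto intro!: derivative_eq_intros)
  then show ?thesis
    unfolding has_divergence_def by (intro exI[of _ "\<lambda>h. h"]) simp
qed

lemma has_laplacian_on_diff:
  assumes "has_laplacian_on u G \<Delta> S" and "has_laplacian_on u' G' \<Delta>' S"
  shows "has_laplacian_on (\<lambda>x. u x - u' x) (\<lambda>x. G x - G' x) (\<lambda>x. \<Delta> x - \<Delta>' x) S"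
  unfolding has_laplacian_on_def
proof (intro ballI conjI)
  fix x assume "x \<in> S"
  with assms have "(u has_derivative (\<lambda>h. G x \<bullet> h)) (at x)" "(u' has_derivative (\<lambda>h. G' x \<bullet> h)) (at x)"
    and div: "has_divergence G (\<Delta> x) x" "has_divergence G' (\<Delta>' x) x"
    by (auto simp: has_laplacian_on_def)
  from has_derivative_diff[OF this(1,2)]
  show "((\<lambda>x. u x - u' x) has_derivative (\<lambda>h. (G x - G' x) \<bullet> h)) (at x)"
    by (simp add: inner_diff_left)
  show "has_divergence (\<lambda>x. G x - G' x) (\<Delta> x - \<Delta>' x) x"
    by (rule has_divergence_diff[OF div])
qed

lemma has_laplacian_on_subset:
  "has_laplacian_on u G \<Delta> S \<Longrightarrow> T \<subseteq> S \<Longrightarrow> has_laplacian_on u G \<Delta> T"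
  by (auto simp: has_laplacian_on_def)

lemma has_laplacian_on_grad_zero_at_min:
  assumes "has_laplacian_on u G \<Delta> S" "open S" "x \<in> S" "\<And>y. y \<in> S \<Longrightarrow> u x \<le> u y"
  shows "G x = 0"
proof -
  have d: "(u has_derivative (\<lambda>h. G x \<bullet> h)) (at x)"
    using assms by (auto simp: has_laplacian_on_def)
  have "(\<lambda>h. G x \<bullet> h) = (\<lambda>h. 0)"
    using differential_zero_maxmin[OF assms(3,2) d] assms(4) by blast
  then have "G x \<bullet> G x = 0"
    by meson
  then show ?thesis by simp
qed

text \<open>
  If the second derivative in a coordinate direction were negative at a minimum, the first
  derivative, which vanishes there, would be negative just after it and the function would
  decrease.
\<close>

lemma laplacian_nonneg_at_min:
  assumes lap: "has_laplacian_on u G \<Delta> S" and S: "open S" "x \<in> S"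
    and min: "\<And>y. y \<in> S \<Longrightarrow> u x \<le> u y"
  shows "\<Delta> x \<ge> 0"
proof -
  obtain L where L: "(G has_derivative L) (at x)" "(\<Sum>b\<in>Basis. L b \<bullet> b) = \<Delta> x"
    using lap S by (auto simp: has_laplacian_on_def has_divergence_def)
  have G0: "G x = 0"
    by (rule has_laplacian_on_grad_zero_at_min[OF lap S min])
  obtain e where e: "e > 0" "ball x e \<subseteq> S"
    using S open_contains_ball by metis
  have "L b \<bullet> b \<ge> 0" if b: "b \<in> Basis" for b
  proof (rule ccontr)
    assume neg: "\<not> L b \<bullet> b \<ge> 0"
    define \<phi> where "\<phi> = (\<lambda>t. u (x + t *\<^sub>R b))"
    define \<psi> where "\<psi> = (\<lambda>t. G (x + t *\<^sub>R b) \<bullet> b)"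
    have inS: "x + t *\<^sub>R b \<in> S" if "\<bar>t\<bar> < e" for t
      using e(2) that b by (auto simp: dist_norm subset_iff)
    have d\<phi>: "(\<phi> has_real_derivative \<psi> t) (at t)" if "\<bar>t\<bar> < e" for t
    proof -
      have u: "(u has_derivative (\<lambda>h. G (x + t *\<^sub>R b) \<bullet> h)) (at (x + t *\<^sub>R b))"
        using lap inS[OF that] by (auto simp: has_laplacian_on_def)
      have "((\<lambda>t. x + t *\<^sub>R b) has_derivative (\<lambda>h. h *\<^sub>R b)) (at t)"
        by (auto intro!: derivative_eq_intros)
      from has_derivative_compose[OF this u] show ?thesis
        unfolding has_field_derivative_def \<phi>_def \<psi>_def by (simp add: mult.commute[of "G _ \<bullet> b"] o_def mult_commute_abs)
    qed
    have "((\<lambda>t. x + t *\<^sub>R b) has_derivative (\<lambda>h. h *\<^sub>R b)) (at 0)"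
      by (auto intro!: derivative_eq_intros)
    moreover have "(G has_derivative L) (at (x + 0 *\<^sub>R b))"
      using L by simp
    ultimately have "((\<lambda>t. G (x + t *\<^sub>R b)) has_derivative (\<lambda>h. L (h *\<^sub>R b))) (at 0)"
      by (rule has_derivative_compose)
    then have "(\<psi> has_derivative (\<lambda>h. L (h *\<^sub>R b) \<bullet> b)) (at 0)"
      unfolding \<psi>_def by (auto intro!: derivative_eq_intros)
    moreover have "L (h *\<^sub>R b) = h *\<^sub>R L b" for h
      using has_derivative_linear[OF L(1)] by (rule linear_cmul)
    ultimately have d\<psi>: "(\<psi> has_real_derivative (L b \<bullet> b)) (at 0)"
      unfolding has_field_derivative_def by (simp add: mult_commute_abs mult.commute)
    obtain d where d: "d > 0" "\<And>h. h > 0 \<Longrightarrow> h < d \<Longrightarrow> \<psi> (0 + h) < \<psi> 0"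
      using DERIV_neg_dec_right[OF d\<psi>] neg by auto
    define t where "t = min d e / 2"
    have t: "t > 0" "t < d" "t < e"
      using d(1) e(1) by (auto simp: t_def)
    have "\<phi> t < \<phi> 0"
    proof (rule DERIV_neg_imp_decreasing_open[OF t(1)])
      fix r assume r: "0 < r" "r < t"
      have "\<psi> r < 0"
        using d(2)[of r] r t G0 by (simp add: \<psi>_def)
      moreover have "DERIV \<phi> r :> \<psi> r"
        using d\<phi> r t by auto
      ultimately show "\<exists>y. DERIV \<phi> r :> y \<and> y < 0" by blast
    next
      show "continuous_on {0..t} \<phi>"
      proof (intro continuous_at_imp_continuous_on ballI)
        fix r assume "r \<in> {0..t}"
        then show "isCont \<phi> r"
          using DERIV_isCont[OF d\<phi>[of r]] t by auto
      qed
    qed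
    moreover have "u x \<le> u (x + t *\<^sub>R b)"
      using min inS t by auto
    ultimately show False
      by (simp add: \<phi>_def)
  qed
  then show ?thesis
    unfolding L(2)[symmetric] by (intro sum_nonneg) auto
qed

text \<open>
  A negative minimum over \<open>K\<close> would be attained in \<open>S\<close>, where the Laplacian would be nonnegative.
\<close>

lemma nonneg_on_compact_if_superharmonic_where_negative:
  assumes K: "compact K" and cont: "continuous_on K F"
    and S: "open S" and lap: "has_laplacian_on F G \<Delta> S"
    and bdry: "\<And>x. x \<in> K - S \<Longrightarrow> F x \<ge> 0" and "S \<subseteq> K"
    and neg: "\<And>x. x \<in> S \<Longrightarrow> F x < 0 \<Longrightarrow> \<Delta> x < 0"
    and x: "x \<in> K"
  shows "F x \<ge> 0"
proof (rule ccontr)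
  assume *: "\<not> F x \<ge> 0"
  obtain m where m: "m \<in> K" "\<And>y. y \<in> K \<Longrightarrow> F m \<le> F y"
    using continuous_attains_inf[OF K _ cont] x by blast
  have "F m < 0"
    using * m(2)[OF x] by simp
  then have "m \<in> S"
    using bdry[of m] m(1) by force
  moreover have "\<Delta> m \<ge> 0"
    using laplacian_nonneg_at_min[OF lap S \<open>m \<in> S\<close>] m(2) assms(6) by blast
  ultimately show False
    using neg \<open>F m < 0\<close> by force
qed

section \<open>Inversions and the Kelvin transform\<close>

definition inversion_factor :: "real \<Rightarrow> 'a::euclidean_space \<Rightarrow> 'a \<Rightarrow> real" where
  "inversion_factor r c y = r\<^sup>2 / ((y - c) \<bullet> (y - c))"

definition sphere_inversion :: "real \<Rightarrow> 'a::euclidean_space \<Rightarrow> 'a \<Rightarrow> 'a" where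
  "sphere_inversion r c y = c + inversion_factor r c y *\<^sub>R (y - c)"

text \<open>
  The power of the conformal factor by which a function must be multiplied so that the conformal
  Laplacian transforms by a mere factor; it is half of the decay rate \<open>n - 2\<close> of the Newton
  kernel.
\<close>

definition conformal_weight :: "'a::euclidean_space itself \<Rightarrow> real" where
  "conformal_weight _ = (real DIM('a) - 2) / 2"

definition kelvin :: "real \<Rightarrow> 'a::euclidean_space \<Rightarrow> ('a \<Rightarrow> real) \<Rightarrow> 'a \<Rightarrow> real" where
  "kelvin r c u y = inversion_factor r c y powr conformal_weight TYPE('a) * u (sphere_inversion r c y)"

text \<open>
  The gradient of the Kelvin transform, arranged as a transported gradient minus a multiple of
  \<open>y - c\<close>, since the divergence of the second part involves radial derivatives only.
\<close>

definition kelvin_grad ::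
    "real \<Rightarrow> 'a::euclidean_space \<Rightarrow> ('a \<Rightarrow> real) \<Rightarrow> ('a \<Rightarrow> 'a) \<Rightarrow> 'a \<Rightarrow> 'a" where
  "kelvin_grad r c u G y =
     (let a = conformal_weight TYPE('a); q = inversion_factor r c y; s = (y - c) \<bullet> (y - c);
          z = sphere_inversion r c y
      in (q powr (a + 1)) *\<^sub>R G z
         - (2 / s * (q powr (a + 1) * ((y - c) \<bullet> G z) + a * q powr a * u z)) *\<^sub>R (y - c))"

lemma inversion_factor_pos: "r > 0 \<Longrightarrow> y \<noteq> c \<Longrightarrow> inversion_factor r c y > 0"
  by (simp add: inversion_factor_def)

lemma has_derivative_inversion_factor:
  assumes "y \<noteq> c"
  shows "(inversion_factor r c has_derivative
           (\<lambda>h. - 2 * inversion_factor r c y / ((y - c) \<bullet> (y - c)) * ((y - c) \<bullet> h))) (at y)"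
  unfolding inversion_factor_def
  using assms by (auto intro!: derivative_eq_intros simp: field_simps power2_eq_square inner_commute)

lemma has_derivative_inversion_factor_powr:
  assumes "y \<noteq> c" "r > 0"
  shows "((\<lambda>y. inversion_factor r c y powr b) has_derivative
           (\<lambda>h. - 2 * b * inversion_factor r c y powr b / ((y - c) \<bullet> (y - c)) * ((y - c) \<bullet> h))) (at y)"
proof -
  have q: "inversion_factor r c y > 0"
    using assms by (simp add: inversion_factor_pos)
  show ?thesis
    using has_derivative_powr[OF has_derivative_inversion_factor[OF assms(1)] has_derivative_const q UNIV_I, of b] q
    by (simp add: field_simps)
qed

lemma has_derivative_sphere_inversion:
  assumes "y \<noteq> c"
  shows "(sphere_inversion r c has_derivative
           (\<lambda>h. inversion_factor r c y *\<^sub>R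
             (h - (2 / ((y - c) \<bullet> (y - c)) * ((y - c) \<bullet> h)) *\<^sub>R (y - c)))) (at y)"
  unfolding sphere_inversion_def
  by (rule derivative_eq_intros has_derivative_inversion_factor assms refl | simp)+
     (simp add: algebra_simps)

lemma kelvin_has_derivative:
  fixes y :: "'a::euclidean_space"
  assumes "y \<noteq> c" "r > 0"
    and u: "(u has_derivative (\<lambda>h. G (sphere_inversion r c y) \<bullet> h)) (at (sphere_inversion r c y))"
  shows "(kelvin r c u has_derivative (\<lambda>h. kelvin_grad r c u G y \<bullet> h)) (at y)"
proof -
  define q d z where "q = inversion_factor r c y" and "d = y - c" and "z = sphere_inversion r c y"
  have q: "q > 0"
    using assms by (simp add: inversion_factor_pos q_def)
  have qp: "q powr (b + 1) = q powr b * q" for b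
    using q by (simp add: powr_add)
  have "((\<lambda>y. u (sphere_inversion r c y)) has_derivative
           (\<lambda>h. G (sphere_inversion r c y) \<bullet> (inversion_factor r c y *\<^sub>R
             (h - (2 / ((y - c) \<bullet> (y - c)) * ((y - c) \<bullet> h)) *\<^sub>R (y - c))))) (at y)"
    by (rule has_derivative_compose[OF has_derivative_sphere_inversion[OF assms(1)] u])
  from has_derivative_mult[OF has_derivative_inversion_factor_powr[OF assms(1,2), of "conformal_weight TYPE('a)"] this]
  show ?thesis
    unfolding kelvin_def[abs_def] kelvin_grad_def Let_def q_def[symmetric] qp d_def[symmetric]
      z_def[symmetric]
  proof (rule has_derivative_eq_rhs, intro ext)
    fix h
    show "q powr conformal_weight TYPE('a) * (G z \<bullet> q *\<^sub>R (h - (2 / (d \<bullet> d) * (d \<bullet> h)) *\<^sub>R d)) +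
         - 2 * conformal_weight TYPE('a) * q powr conformal_weight TYPE('a) / (d \<bullet> d) * (d \<bullet> h) * u z =
         ((q powr conformal_weight TYPE('a) * q) *\<^sub>R G z - (2 / (d \<bullet> d) * (q powr conformal_weight TYPE('a) * q * (d \<bullet> G z) +
            conformal_weight TYPE('a) * q powr conformal_weight TYPE('a) * u z)) *\<^sub>R d) \<bullet> h"
      (is "?l = ?r")
    proof -
      define A e G1 d1 D1 a where "A = q powr conformal_weight TYPE('a)" and "e = 2 / (d \<bullet> d)"
        and "G1 = G z \<bullet> h" and "d1 = d \<bullet> h" and "D1 = d \<bullet> G z" and "a = conformal_weight TYPE('a)"
      have "?l = A * (q * (G1 - e * d1 * D1)) - a * A * e * d1 * u z"
        unfolding inner_scaleR_right inner_diff_right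
        by (simp add: A_def e_def G1_def d1_def D1_def a_def inner_commute)
      also have "\<dots> = A * q * G1 - e * (A * q * D1 + a * A * u z) * d1"
        by (simp add: algebra_simps)
      also have "\<dots> = ?r"
        unfolding inner_scaleR_left inner_diff_left
        by (simp add: A_def e_def G1_def d1_def D1_def a_def)
      finally show ?thesis .
    qed
  qed
qed

text \<open>
  The Kelvin transform intertwines Laplacians. By the product rule, only the divergence of the
  transported gradient and derivatives in the direction \<open>d = y - c\<close> enter, and these are simple
  because the inversion maps the ray through \<open>y\<close> to itself: its differential sends \<open>d\<close> to \<open>- q d\<close>.
  The terms in \<open>u\<close>, in the radial derivative and in the radial second derivative cancel
  separately, the first two because the dimension is \<open>2 a + 2\<close>.
\<close>

lemma has_divergence_kelvin_grad:
  fixes y :: "'a::euclidean_space" and c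
  defines "a \<equiv> conformal_weight TYPE('a)"
  assumes y: "y \<noteq> c" "r > 0"
    and u: "(u has_derivative (\<lambda>h. G (sphere_inversion r c y) \<bullet> h)) (at (sphere_inversion r c y))"
    and G: "has_divergence G l (sphere_inversion r c y)"
  shows "has_divergence (kelvin_grad r c u G) (inversion_factor r c y powr (a + 2) * l) y"
proof -
  define q s z d where "q = inversion_factor r c y" and "s = (y - c) \<bullet> (y - c)"
    and "z = sphere_inversion r c y" and "d = y - c"
  have q: "q > 0"
    using y by (simp add: inversion_factor_pos q_def)
  have s: "s > 0"
    using y by (simp add: s_def)
  have dd: "d \<bullet> d = s"
    by (simp add: d_def s_def)
  have q1: "q powr (a + 1) = q powr a * q" and q2: "q powr (a + 2) = q powr a * q * q"
    using q by (simp_all add: powr_add power2_eq_square)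
  have N: "real DIM('a) = 2 * a + 2"
    by (simp add: a_def conformal_weight_def field_simps)
  obtain H where H: "(G has_derivative H) (at z)" "(\<Sum>b\<in>Basis. H b \<bullet> b) = l"
    using G by (auto simp: has_divergence_def z_def)
  have linH: "linear H"
    using H(1) has_derivative_linear by blast
  define Dz where "Dz = (\<lambda>h. q *\<^sub>R (h - (2 / s * (d \<bullet> h)) *\<^sub>R d))"
  have Dz: "(sphere_inversion r c has_derivative Dz) (at y)"
    using has_derivative_sphere_inversion[OF y(1), of r] by (simp add: Dz_def q_def s_def d_def)
  have Dzd: "Dz d = (- q) *\<^sub>R d"
    using s by (simp add: Dz_def dd scaleR_2)
  have F: "((\<lambda>y. G (sphere_inversion r c y)) has_derivative (\<lambda>h. H (Dz h))) (at y)"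
    using has_derivative_compose[OF Dz] H(1) by (simp add: z_def)
  have U: "((\<lambda>y. u (sphere_inversion r c y)) has_derivative (\<lambda>h. G z \<bullet> Dz h)) (at y)"
    using has_derivative_compose[OF Dz u] by (simp add: z_def)
  have "(\<Sum>b\<in>Basis. H (Dz b) \<bullet> b) = q * l - 2 * q / s * (H d \<bullet> d)"
  proof -
    have "H (Dz b) \<bullet> b = q * (H b \<bullet> b) - 2 * q / s * ((d \<bullet> b) * (H d \<bullet> b))" for b
      by (simp add: Dz_def linear_cmul[OF linH] linear_diff[OF linH] inner_diff_left algebra_simps)
    then show ?thesis
      by (simp only: sum_subtractf sum_distrib_left[symmetric] H(2) euclidean_inner[symmetric] inner_commute[of "H d" d])
  qed
  then have divF: "has_divergence (\<lambda>y. G (sphere_inversion r c y)) (q * l - 2 * q / s * (H d \<bullet> d)) y"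
    using F unfolding has_divergence_def by blast
  define m where "m = (\<lambda>y. 2 / ((y - c) \<bullet> (y - c)) *
      (inversion_factor r c y powr (a + 1) * ((y - c) \<bullet> G (sphere_inversion r c y))
       + a * (inversion_factor r c y powr a * u (sphere_inversion r c y))))"
  define X where "X = d \<bullet> G z"
  \<comment> \<open>the differential of the coefficient \<open>m\<close>, in the unsimplified shape that the product
      rule yields\<close>
  define M where "M = (\<lambda>h. 2 / s * ((q powr (a + 1) * (h \<bullet> G z + d \<bullet> H (Dz h))
        + (- 2 * (a + 1) * q powr (a + 1) / s * (d \<bullet> h)) * X)
      + a * (q powr a * (G z \<bullet> Dz h) + (- 2 * a * q powr a / s * (d \<bullet> h)) * u z))
      + (- 4 / (s * s) * (d \<bullet> h)) * (q powr (a + 1) * X + a * (q powr a * u z)))"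
  have s': "((\<lambda>y. 2 / ((y - c) \<bullet> (y - c))) has_derivative (\<lambda>h. - 4 / (s * s) * (d \<bullet> h))) (at y)"
    using y s unfolding s_def d_def
    by (auto intro!: derivative_eq_intros simp: field_simps power2_eq_square inner_commute)
  have X': "((\<lambda>y. (y - c) \<bullet> G (sphere_inversion r c y)) has_derivative (\<lambda>h. h \<bullet> G z + d \<bullet> H (Dz h))) (at y)"
  proof -
    have "((\<lambda>y. y - c) has_derivative (\<lambda>h. h)) (at y)"
      by (auto intro!: derivative_eq_intros)
    from has_derivative_inner[OF this F] show ?thesis
      by (simp add: d_def z_def add.commute)
  qed
  have qa: "((\<lambda>y. inversion_factor r c y powr b) has_derivative
           (\<lambda>h. - 2 * b * q powr b / s * (d \<bullet> h))) (at y)" for b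
    using has_derivative_inversion_factor_powr[OF y, of b] by (simp add: q_def s_def d_def)
  have "(m has_derivative M) (at y)"
    using has_derivative_mult[OF s' has_derivative_add[OF has_derivative_mult[OF qa[of "a + 1"] X']
          has_derivative_mult_right[OF has_derivative_mult[OF qa[of a] U], of a]]]
    by (simp only: m_def M_def X_def dd q_def[symmetric] z_def[symmetric] d_def[symmetric] s_def[symmetric])
  from has_divergence_scaleR[OF this has_divergence_position[of c y]]
  have "has_divergence (\<lambda>y. m y *\<^sub>R (y - c)) (m y * (2 * a + 2) + M d) y"
    by (simp only: N d_def)
  moreover have "has_divergence (\<lambda>y. inversion_factor r c y powr (a + 1) *\<^sub>R G (sphere_inversion r c y))
      (q powr (a + 1) * (q * l - 2 * q / s * (H d \<bullet> d)) + (- 2 * (a + 1) * q powr (a + 1) / s * X)) y"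
    using has_divergence_scaleR[OF qa[of "a + 1"] divF] by (simp add: q_def z_def X_def)
  ultimately have *: "has_divergence (\<lambda>y. inversion_factor r c y powr (a + 1) *\<^sub>R G (sphere_inversion r c y)
       - m y *\<^sub>R (y - c))
      (q powr (a + 1) * (q * l - 2 * q / s * (H d \<bullet> d)) + (- 2 * (a + 1) * q powr (a + 1) / s * X)
       - (m y * (2 * a + 2) + M d)) y"
    using has_divergence_diff by blast
  \<comment> \<open>opaque names for the powers and the quotient turn what remains into a polynomial
      identity\<close>
  define A t Y where "A = q powr a" and "t = 1 / s" and "Y = H d \<bullet> d"
  have "d \<bullet> H (Dz d) = - q * Y" "G z \<bullet> Dz d = - q * X"
    by (simp_all add: Dzd linear_cmul[OF linH] linear_neg[OF linH] X_def Y_def inner_commute)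
  moreover have "2 / s = 2 * t" "- 2 * (a + 1) * q powr (a + 1) / s * (d \<bullet> d) = - 2 * (a + 1) * (A * q)"
    "- 2 * a * q powr a / s * (d \<bullet> d) = - 2 * a * A" "- 4 / (s * s) * (d \<bullet> d) = - 4 * t"
    using s by (simp_all add: t_def dd q1 A_def)
  ultimately have Md: "M d = 2 * t * ((A * q * (X - q * Y) - 2 * (a + 1) * (A * q) * X)
      + a * (A * (- q * X) - 2 * a * A * u z)) - 4 * t * (A * q * X + a * (A * u z))"
    unfolding M_def by (simp add: q1 A_def X_def) (simp add: algebra_simps)
  have my: "m y = 2 * t * (A * q * X + a * (A * u z))"
    by (simp add: m_def q_def s_def X_def d_def z_def A_def q1[unfolded q_def] t_def)
  have "q powr (a + 1) * (q * l - 2 * q / s * (H d \<bullet> d)) + (- 2 * (a + 1) * q powr (a + 1) / s * X)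
       - (m y * (2 * a + 2) + M d)
     = A * q * (q * l - 2 * q * t * Y) - 2 * (a + 1) * (A * q) * t * X - (m y * (2 * a + 2) + M d)"
    using s by (simp add: q1 A_def t_def Y_def) (simp add: field_simps)
  also have "\<dots> = q powr (a + 2) * l"
    unfolding q2 A_def[symmetric] Md my by (simp add: algebra_simps)
  finally have "q powr (a + 1) * (q * l - 2 * q / s * (H d \<bullet> d)) + (- 2 * (a + 1) * q powr (a + 1) / s * X)
       - (m y * (2 * a + 2) + M d) = q powr (a + 2) * l" .
  moreover have "kelvin_grad r c u G = (\<lambda>y. inversion_factor r c y powr (a + 1) *\<^sub>R G (sphere_inversion r c y)
       - m y *\<^sub>R (y - c))"
    by (simp add: fun_eq_iff kelvin_grad_def Let_def m_def a_def)
  ultimately show ?thesis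
    using * by (simp add: q_def)
qed

lemma has_laplacian_on_kelvin:
  fixes u :: "'a::euclidean_space \<Rightarrow> real"
  assumes "has_laplacian_on u G \<Delta> UNIV" "r > 0"
  shows "has_laplacian_on (kelvin r c u) (kelvin_grad r c u G)
           (\<lambda>y. inversion_factor r c y powr (conformal_weight TYPE('a) + 2) * \<Delta> (sphere_inversion r c y)) (- {c})"
  unfolding has_laplacian_on_def
proof (intro ballI conjI)
  fix y assume "y \<in> - {c}"
  then have y: "y \<noteq> c" by simp
  have u: "(u has_derivative (\<lambda>h. G x \<bullet> h)) (at x)" "has_divergence G (\<Delta> x) x" for x
    using assms(1) by (auto simp: has_laplacian_on_def)
  show "(kelvin r c u has_derivative (\<lambda>h. kelvin_grad r c u G y \<bullet> h)) (at y)"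
    by (rule kelvin_has_derivative[where G = G, OF y assms(2) u(1)[of "sphere_inversion r c y"]])
  show "has_divergence (kelvin_grad r c u G)
      (inversion_factor r c y powr (conformal_weight TYPE('a) + 2) * \<Delta> (sphere_inversion r c y)) y"
    by (rule has_divergence_kelvin_grad[where G = G, OF y assms(2) u[of "sphere_inversion r c y"]])
qed

lemma inversion_factor_norm: "inversion_factor r c y = (r / norm (y - c))\<^sup>2"
  by (simp add: inversion_factor_def power2_norm_eq_inner power_divide)

lemma dist_sphere_inversion_center:
  assumes "y \<noteq> c"
  shows "norm (sphere_inversion r c y - c) = r\<^sup>2 / norm (y - c)"
  using assms by (simp add: sphere_inversion_def inversion_factor_norm power_divide power2_eq_square)

lemma kelvin_on_sphere:
  assumes "norm (y - c) = r" "r > 0"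
  shows "kelvin r c u y = u y"
  using assms by (simp add: kelvin_def sphere_inversion_def inversion_factor_norm)

lemma has_laplacian_on_imp_continuous:
  assumes "has_laplacian_on u G \<Delta> S" "x \<in> S"
  shows "isCont u x" "isCont G x"
  using assms by (auto simp: has_laplacian_on_def has_divergence_def intro: has_derivative_continuous)

lemma has_laplacian_on_isCont_comp:
  assumes "has_laplacian_on u G \<Delta> UNIV"
  shows "(g \<longlongrightarrow> x) F \<Longrightarrow> ((\<lambda>t. u (g t)) \<longlongrightarrow> u x) F"
    and "(g \<longlongrightarrow> x) F \<Longrightarrow> ((\<lambda>t. G (g t)) \<longlongrightarrow> G x) F"
  using isCont_tendsto_compose has_laplacian_on_imp_continuous[OF assms UNIV_I] by blast+

text \<open>
  The fundamental solution \<open>|y - c|\<^sup>2\<^sup>-\<^sup>n\<close> up to a constant; as the Kelvin transform of a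
  constant it is harmonic without further computation.
\<close>

definition newton_kernel :: "'a::euclidean_space \<Rightarrow> 'a \<Rightarrow> real" where
  "newton_kernel c = kelvin 1 c (\<lambda>_. 1)"

lemma newton_kernel_eq:
  fixes y :: "'a::euclidean_space"
  assumes "y \<noteq> c"
  shows "newton_kernel c y = norm (y - c) powr (- (2 * conformal_weight TYPE('a)))"
proof -
  have "norm (y - c) > 0" using assms by simp
  then show ?thesis
    by (simp add: newton_kernel_def kelvin_def inversion_factor_norm powr_minus_divide powr_divide
      power_divide powr_powr[symmetric] powr_numeral)
qed

lemma has_laplacian_on_newton_kernel:
  fixes c :: "'a::euclidean_space"
  shows "has_laplacian_on (newton_kernel c) 
     (\<lambda>y. - (2 * conformal_weight TYPE('a) * newton_kernel c y / ((y - c) \<bullet> (y - c))) *\<^sub>R (y - c)) (\<lambda>_. 0) (- {c})"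
proof -
  have "has_divergence (\<lambda>_. 0) 0 (x::'a)" for x
    unfolding has_divergence_def by (intro exI[of _ "\<lambda>_. 0"]) auto
  then have "has_laplacian_on (\<lambda>_. 1) (\<lambda>_. 0) (\<lambda>_. 0) (UNIV::'a set)"
    by (simp add: has_laplacian_on_def)
  from has_laplacian_on_kelvin[OF this, of 1 c]
  have *: "has_laplacian_on (newton_kernel c) (kelvin_grad 1 c (\<lambda>_. 1) (\<lambda>_. 0)) (\<lambda>_. 0) (- {c})"
    by (simp add: newton_kernel_def)
  have "kelvin_grad 1 c (\<lambda>_. 1) (\<lambda>_. 0) = (\<lambda>y. - (2 * conformal_weight TYPE('a) * newton_kernel c y / ((y - c) \<bullet> (y - c))) *\<^sub>R (y - c))"
    by (rule ext) (simp add: kelvin_grad_def newton_kernel_def kelvin_def Let_def)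
  with * show ?thesis by simp
qed

lemma has_laplacian_on_affine:
  assumes "has_laplacian_on u G \<Delta> S"
  shows "has_laplacian_on (\<lambda>y. \<alpha> + \<beta> * u y) (\<lambda>y. \<beta> *\<^sub>R G y) (\<lambda>y. \<beta> * \<Delta> y) S"
  unfolding has_laplacian_on_def
proof (intro ballI conjI)
  fix x assume "x \<in> S"
  with assms have u: "(u has_derivative (\<lambda>h. G x \<bullet> h)) (at x)" and div: "has_divergence G (\<Delta> x) x"
    by (auto simp: has_laplacian_on_def)
  show "((\<lambda>y. \<alpha> + \<beta> * u y) has_derivative (\<lambda>h. (\<beta> *\<^sub>R G x) \<bullet> h)) (at x)"
    using u by (auto intro!: derivative_eq_intros)
  show "has_divergence (\<lambda>y. \<beta> *\<^sub>R G y) (\<beta> * \<Delta> x) x"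
    using has_divergence_scaleR[OF has_derivative_const div, of \<beta>] by simp
qed

lemma tendsto_kelvin:
  fixes c :: "'b \<Rightarrow> 'a::euclidean_space"
  assumes lap: "has_laplacian_on u G \<Delta> UNIV"
    and lim: "(r \<longlongrightarrow> r0) F" "(c \<longlongrightarrow> c0) F" "(y \<longlongrightarrow> y0) F" and "y0 \<noteq> c0" "r0 > 0"
  shows "((\<lambda>t. kelvin (r t) (c t) u (y t)) \<longlongrightarrow> kelvin r0 c0 u y0) F"
    and "((\<lambda>t. kelvin_grad (r t) (c t) u G (y t)) \<longlongrightarrow> kelvin_grad r0 c0 u G y0) F"
proof -
  have s: "((\<lambda>t. (y t - c t) \<bullet> (y t - c t)) \<longlongrightarrow> (y0 - c0) \<bullet> (y0 - c0)) F"
    by (intro tendsto_intros lim)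
  have s0: "(y0 - c0) \<bullet> (y0 - c0) \<noteq> 0"
    using assms by simp
  have q: "((\<lambda>t. inversion_factor (r t) (c t) (y t)) \<longlongrightarrow> inversion_factor r0 c0 y0) F"
    unfolding inversion_factor_def by (intro tendsto_intros s s0 lim)
  have qp: "((\<lambda>t. inversion_factor (r t) (c t) (y t) powr b) \<longlongrightarrow> inversion_factor r0 c0 y0 powr b) F" for b
    using inversion_factor_pos[of r0 y0 c0] assms by (intro tendsto_powr q tendsto_const) auto
  have z: "((\<lambda>t. sphere_inversion (r t) (c t) (y t)) \<longlongrightarrow> sphere_inversion r0 c0 y0) F"
    unfolding sphere_inversion_def by (intro tendsto_intros q lim)
  show "((\<lambda>t. kelvin (r t) (c t) u (y t)) \<longlongrightarrow> kelvin r0 c0 u y0) F"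
    unfolding kelvin_def by (intro tendsto_mult qp has_laplacian_on_isCont_comp(1)[OF lap] z)
  show "((\<lambda>t. kelvin_grad (r t) (c t) u G (y t)) \<longlongrightarrow> kelvin_grad r0 c0 u G y0) F"
    unfolding kelvin_grad_def Let_def
    by (intro tendsto_intros qp s s0 lim has_laplacian_on_isCont_comp[OF lap] z)
qed

section \<open>Moving spheres through the origin\<close>

text \<open>
  The moving sphere argument sees the equation only through the last assumption, the sign
  condition at points outside the ball where \<open>u\<close> lies above its Kelvin transform. By the
  assumption on decay, \<open>u\<close> is at infinity at least of the order of the Newton kernel.
\<close>

locale moving_spheres =
  fixes u :: "'a::euclidean_space \<Rightarrow> real" and G :: "'a \<Rightarrow> 'a" and \<Delta> :: "'a \<Rightarrow> real"
    and a :: real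
  assumes weight: "a = conformal_weight TYPE('a)" and dim: "DIM('a) \<ge> 3"
    and lap: "has_laplacian_on u G \<Delta> UNIV"
    and pos: "u x > 0"
    and decay: "\<exists>k>0. \<forall>x. k * (1 + (norm x)\<^sup>2) powr (- a) \<le> u x"
    and laplacian_less: "\<lbrakk>norm e = 1; r > 0; norm (y - r *\<^sub>R e) > r; kelvin r (r *\<^sub>R e) u y \<le> u y\<rbrakk> \<Longrightarrow>
       \<Delta> y < inversion_factor r (r *\<^sub>R e) y powr (a + 2)
               * \<Delta> (sphere_inversion r (r *\<^sub>R e) y)"
begin

definition gap :: "'a \<Rightarrow> real \<Rightarrow> 'a \<Rightarrow> real" where
  "gap e r y = u y - kelvin r (r *\<^sub>R e) u y"

definition gap_grad :: "'a \<Rightarrow> real \<Rightarrow> 'a \<Rightarrow> 'a" where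
  "gap_grad e r y = G y - kelvin_grad r (r *\<^sub>R e) u G y"

definition dominates :: "'a \<Rightarrow> real \<Rightarrow> bool" where
  "dominates e r \<longleftrightarrow> (\<forall>y. norm (y - r *\<^sub>R e) \<ge> r \<longrightarrow> gap e r y \<ge> 0)"

lemma a_pos: "a > 0"
  using dim by (simp add: weight conformal_weight_def)

lemma newton_kernel_eq_powr: "y \<noteq> c \<Longrightarrow> newton_kernel c (y :: 'a) = norm (y - c) powr (- (2 * a))"
  by (simp add: newton_kernel_eq weight)

lemma has_laplacian_on_newton_kernel_powr:
  fixes c :: 'a
  shows "has_laplacian_on (newton_kernel c)
     (\<lambda>y. - (2 * a * newton_kernel c y / ((y - c) \<bullet> (y - c))) *\<^sub>R (y - c)) (\<lambda>_. 0) (- {c})"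
  unfolding weight by (rule has_laplacian_on_newton_kernel)

lemma gap_on_sphere: "r > 0 \<Longrightarrow> norm (y - r *\<^sub>R e) = r \<Longrightarrow> gap e r y = 0"
  by (simp add: gap_def kelvin_on_sphere)

lemma has_laplacian_on_gap:
  assumes "r > 0"
  shows "has_laplacian_on (gap e r) (gap_grad e r)
     (\<lambda>y. \<Delta> y - inversion_factor r (r *\<^sub>R e) y powr (a + 2) * \<Delta> (sphere_inversion r (r *\<^sub>R e) y))
     (- {r *\<^sub>R e})"
  using has_laplacian_on_diff[OF has_laplacian_on_subset[OF lap subset_UNIV] has_laplacian_on_kelvin[OF lap assms]]
  unfolding gap_def[abs_def] gap_grad_def[abs_def] weight by blast

lemma tendsto_gap:
  assumes "(r \<longlongrightarrow> r0) F" "(y \<longlongrightarrow> y0) F" "y0 \<noteq> r0 *\<^sub>R e" "r0 > 0"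
  shows "((\<lambda>t. gap e (r t) (y t)) \<longlongrightarrow> gap e r0 y0) F"
    and "((\<lambda>t. gap_grad e (r t) (y t)) \<longlongrightarrow> gap_grad e r0 y0) F"
  unfolding gap_def gap_grad_def using assms
  by (auto intro!: tendsto_diff tendsto_kelvin[OF lap] has_laplacian_on_isCont_comp[OF lap] tendsto_scaleR)

lemma continuous_on_gap: "r > 0 \<Longrightarrow> r *\<^sub>R e \<notin> K \<Longrightarrow> continuous_on K (gap e r)"
  by (intro continuous_at_imp_continuous_on ballI has_laplacian_on_imp_continuous(1)[OF has_laplacian_on_gap]) auto

lemma gap_strictly_superharmonic:
  assumes "norm e = 1" "r > 0" "dominates e r" "norm (y - r *\<^sub>R e) > r"
  shows "\<Delta> y - inversion_factor r (r *\<^sub>R e) y powr (a + 2) * \<Delta> (sphere_inversion r (r *\<^sub>R e) y) < 0"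
  using laplacian_less[OF assms(1,2,4)] assms(3,4) by (simp add: dominates_def gap_def)

text \<open>
  A zero outside the ball would be a minimum of the gap, at which its Laplacian is nonnegative,
  against strict superharmonicity.
\<close>

lemma gap_pos_outside:
  assumes "norm e = 1" "r > 0" "dominates e r" "norm (y - r *\<^sub>R e) > r"
  shows "gap e r y > 0"
proof (rule ccontr)
  assume *: "\<not> gap e r y > 0"
  define S where "S = {y. norm (y - r *\<^sub>R e) > r}"
  have S: "open S"
    unfolding S_def by (intro open_Collect_less continuous_intros)
  have sub: "S \<subseteq> - {r *\<^sub>R e}"
    using assms(2) by (auto simp: S_def)
  have "\<Delta> y - inversion_factor r (r *\<^sub>R e) y powr (a + 2) * \<Delta> (sphere_inversion r (r *\<^sub>R e) y) \<ge> 0"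
  proof (rule laplacian_nonneg_at_min[OF has_laplacian_on_subset[OF has_laplacian_on_gap[OF assms(2)] sub] S])
    show "y \<in> S" using assms(4) by (simp add: S_def)
    show "gap e r y \<le> gap e r x" if "x \<in> S" for x
      using * assms(3) that by (simp add: dominates_def S_def) (smt (verit))
  qed
  with gap_strictly_superharmonic[OF assms] show False by simp
qed

text \<open>
  Subtracting a harmonic barrier leaves the gap strictly superharmonic, so the comparison on the
  two boundary spheres carries over to the annulus.
\<close>

lemma gap_ge_barrier_on_annulus:
  fixes \<alpha> \<beta> r1 r2 :: real
  assumes e: "norm e = 1" "r > 0" "dominates e r" and r: "r \<le> r1"
    and bdry: "\<And>y. norm (y - r *\<^sub>R e) = r1 \<or> norm (y - r *\<^sub>R e) = r2 \<Longrightarrow>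
      \<alpha> + \<beta> * newton_kernel (r *\<^sub>R e) y \<le> gap e r y"
    and x: "r1 \<le> norm (x - r *\<^sub>R e)" "norm (x - r *\<^sub>R e) \<le> r2"
  shows "\<alpha> + \<beta> * newton_kernel (r *\<^sub>R e) x \<le> gap e r x"
proof -
  define c where "c = r *\<^sub>R e"
  define K where "K = cball c r2 - ball c r1"
  define S where "S = {y. r1 < norm (y - c)} \<inter> {y. norm (y - c) < r2}"
  define F where "F = (\<lambda>y. gap e r y - (\<alpha> + \<beta> * newton_kernel c y))"
  define D where "D = (\<lambda>y. (\<Delta> y - inversion_factor r (r *\<^sub>R e) y powr (a + 2) * \<Delta> (sphere_inversion r (r *\<^sub>R e) y)) - \<beta> * 0)"
  obtain GF where lapF: "has_laplacian_on F GF D (- {c})"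
    using has_laplacian_on_diff[OF has_laplacian_on_gap[OF e(2)] has_laplacian_on_affine[OF has_laplacian_on_newton_kernel_powr]]
    unfolding F_def c_def D_def by blast
  have nc: "c \<notin> K" "c \<notin> S"
    using e(2) r by (auto simp: K_def S_def)
  have "F x \<ge> 0"
  proof (rule nonneg_on_compact_if_superharmonic_where_negative[where F = F and x = x and K = K and S = S and \<Delta> = D and G = GF])
    show "compact K"
      unfolding K_def by (intro compact_diff compact_cball open_ball)
    show "continuous_on K F"
      using nc by (intro continuous_at_imp_continuous_on ballI has_laplacian_on_imp_continuous(1)[OF lapF]) auto
    show "open S"
      unfolding S_def by (intro open_Int open_Collect_less continuous_intros)
    show "has_laplacian_on F GF D S"
      using nc by (intro has_laplacian_on_subset[OF lapF]) auto
    show "F x \<ge> 0" if "x \<in> K - S" for x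
    proof -
      have "norm (x - c) = r1 \<or> norm (x - c) = r2"
        using that by (auto simp: K_def S_def dist_norm norm_minus_commute)
      then show ?thesis
        using bdry[of x] by (simp add: F_def c_def)
    qed
    show "S \<subseteq> K"
      by (auto simp: K_def S_def dist_norm norm_minus_commute)
    show "D x < 0" if "x \<in> S" for x
      using gap_strictly_superharmonic[OF e, of x] that r by (simp add: D_def S_def c_def)
    show "x \<in> K"
      using x by (simp add: K_def c_def dist_norm norm_minus_commute)
  qed
  then show ?thesis
    by (simp add: F_def c_def)
qed

lemma newton_kernel_strict_antimono:
  assumes "0 < norm (x - c)" "norm (x - c) < norm (y - c)"
  shows "newton_kernel c (y::'a) < newton_kernel c x"
proof -
  have "x \<noteq> c" "y \<noteq> c" using assms by auto
  then show ?thesis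
    using assms a_pos by (simp add: newton_kernel_eq_powr powr_minus powr_less_mono2)
qed

lemma gap_lower_bound_on_sphere:
  assumes "norm e = 1" "r > 0" "dominates e r"
  obtains m where "m > 0" "\<And>y. norm (y - r *\<^sub>R e) = 2 * r \<Longrightarrow> m \<le> gap e r y"
proof -
  have nin: "r *\<^sub>R e \<notin> sphere (r *\<^sub>R e) (2 * r)"
    using assms by simp
  have ne: "sphere (r *\<^sub>R e) (2 * r) \<noteq> {}"
    using assms by simp
  obtain x where x: "x \<in> sphere (r *\<^sub>R e) (2 * r)" "\<forall>y\<in>sphere (r *\<^sub>R e) (2 * r). gap e r x \<le> gap e r y"
    using continuous_attains_inf[OF compact_sphere ne continuous_on_gap[OF assms(2) nin]] by blast
  show thesis
  proof (rule that)
    show "gap e r x > 0"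
      using x(1) assms by (intro gap_pos_outside) (auto simp: dist_norm norm_minus_commute)
    show "gap e r x \<le> gap e r y" if "norm (y - r *\<^sub>R e) = 2 * r" for y
      using x(2) that by (auto simp: dist_norm norm_minus_commute)
  qed
qed

text \<open>
  The boundary point lemma of Hopf. The barrier \<open>\<beta> (h(y) - h)\<close>, with \<open>h\<close> the Newton kernel,
  vanishes on the boundary sphere and lies below the gap on the annulus between the radii \<open>r\<close> and
  \<open>2 r\<close>, while its normal derivative at the boundary is positive.
\<close>

lemma gap_grad_nonzero_on_sphere:
  assumes e: "norm e = 1" "r > 0" "dominates e r" and y: "norm (y - r *\<^sub>R e) = r"
  shows "gap_grad e r y \<noteq> 0"
proof
  assume zero: "gap_grad e r y = 0"
  define c d where "c = r *\<^sub>R e" and "d = y - c"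
  define h where "h = newton_kernel c"
  have yc: "y \<noteq> c" using e y by (auto simp: c_def)
  have nd: "norm d = r" using y by (simp add: d_def c_def)
  obtain m where m: "m > 0" "\<And>y. norm (y - r *\<^sub>R e) = 2 * r \<Longrightarrow> m \<le> gap e r y"
    using gap_lower_bound_on_sphere[OF e] by blast
  define h2 where "h2 = h (c + 2 *\<^sub>R d)"
  have hradial: "h x = h x'" if "norm (x - c) = norm (x' - c)" "norm (x - c) > 0" for x x'
  proof -
    have "x \<noteq> c" using that(2) by auto
    moreover have "x' \<noteq> c" using that by auto
    ultimately show ?thesis using that by (simp add: h_def newton_kernel_eq_powr)
  qed
  have h2: "h2 < h y"
    unfolding h2_def h_def using nd e(2) by (intro newton_kernel_strict_antimono) (auto simp: d_def)
  \<comment> \<open>chosen so that the barrier equals \<open>m\<close>, the lower bound of the gap, on the sphere of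
      radius \<open>2 r\<close>\<close>
  define \<beta> where "\<beta> = m / (h y - h2)"
  have \<beta>: "\<beta> > 0" using m h2 by (simp add: \<beta>_def)
  have bar: "\<beta> * h y + (- \<beta>) * h x \<le> gap e r x" if "r \<le> norm (x - c)" "norm (x - c) \<le> 2 * r" for x
    unfolding h_def c_def
  proof (rule gap_ge_barrier_on_annulus[OF e order.refl _ that[unfolded c_def]])
    fix x assume x: "norm (x - r *\<^sub>R e) = r \<or> norm (x - r *\<^sub>R e) = 2 * r"
    then show "\<beta> * newton_kernel (r *\<^sub>R e) y + - \<beta> * newton_kernel (r *\<^sub>R e) x \<le> gap e r x"
    proof
      assume x: "norm (x - r *\<^sub>R e) = r"
      then have "h x = h y" using hradial[of x y] y e(2) by (simp add: c_def)
      then show ?thesis using gap_on_sphere[OF e(2) x] by (simp add: h_def c_def)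
    next
      assume x: "norm (x - r *\<^sub>R e) = 2 * r"
      then have "h x = h2" unfolding h2_def using hradial[of x "c + 2 *\<^sub>R d"] nd e(2) by (simp add: c_def)
      moreover have "\<beta> * h y - \<beta> * h2 = m" using h2 by (simp only: \<beta>_def right_diff_distrib[symmetric]) simp
      ultimately show ?thesis using m(2)[OF x] by (simp add: h_def c_def)
    qed
  qed
  define f where "f = (\<lambda>t. gap e r (y + t *\<^sub>R d) - (\<beta> * h y + (- \<beta>) * h (y + t *\<^sub>R d)))"
  have l: "((\<lambda>t. y + t *\<^sub>R d) has_derivative (\<lambda>t. t *\<^sub>R d)) (at 0)"
    by (auto intro!: derivative_eq_intros)
  have "has_laplacian_on (\<lambda>x. gap e r x - (\<beta> * h y + (- \<beta>) * h x))
      (\<lambda>x. gap_grad e r x - (- \<beta>) *\<^sub>R (- (2 * a * newton_kernel c x / ((x - c) \<bullet> (x - c))) *\<^sub>R (x - c)))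
      (\<lambda>x. (\<Delta> x - inversion_factor r (r *\<^sub>R e) x powr (a + 2) * \<Delta> (sphere_inversion r (r *\<^sub>R e) x)) - (- \<beta>) * 0) (- {c})"
    using has_laplacian_on_diff[OF has_laplacian_on_gap[OF e(2)] has_laplacian_on_affine[OF has_laplacian_on_newton_kernel_powr]]
    unfolding c_def h_def by blast
  then have "((\<lambda>x. gap e r x - (\<beta> * h y + (- \<beta>) * h x)) has_derivative
      (\<lambda>v. (gap_grad e r y - (- \<beta>) *\<^sub>R (- (2 * a * h y / (d \<bullet> d)) *\<^sub>R d)) \<bullet> v)) (at (y + 0 *\<^sub>R d))"
    using yc by (simp add: has_laplacian_on_def d_def h_def)
  from has_derivative_compose[OF l this]
  have "(f has_real_derivative (- \<beta> * (2 * a * h y / (d \<bullet> d)) * (d \<bullet> d))) (at 0)"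
    unfolding f_def has_field_derivative_def by (rule has_derivative_eq_rhs) (auto simp: zero)
  moreover have "d \<bullet> d \<noteq> 0" using yc by (simp add: d_def)
  ultimately have f': "(f has_real_derivative (- \<beta> * (2 * a * h y))) (at 0)"
    by (simp add: mult.assoc)
  have "h y > 0" unfolding h_def using yc by (simp add: newton_kernel_eq_powr)
  then have "- \<beta> * (2 * a * h y) < 0" using \<beta> a_pos by simp
  from DERIV_neg_dec_right[OF f' this]
  obtain \<delta> where \<delta>: "\<delta> > 0" "\<And>t. t > 0 \<Longrightarrow> t < \<delta> \<Longrightarrow> f (0 + t) < f 0" by blast
  define t where "t = min (\<delta> / 2) 1"
  have t: "t > 0" "t < \<delta>" "t \<le> 1" using \<delta>(1) by (auto simp: t_def)
  have "y + t *\<^sub>R d - c = (1 + t) *\<^sub>R d" by (simp add: d_def algebra_simps)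
  then have "norm (y + t *\<^sub>R d - c) = (1 + t) * r" using nd t by simp
  then have "f t \<ge> 0"
    unfolding f_def using bar[of "y + t *\<^sub>R d"] t e(2) by simp
  moreover have "f 0 = 0"
    using gap_on_sphere[OF e(2) y] by (simp add: f_def)
  ultimately show False using \<delta>(2)[of t] t by simp
qed

text \<open>
  On the annulus between the radii \<open>2 r\<close> and \<open>R\<close> the gap dominates the multiple of the Newton
  kernel that fits on the inner sphere, lowered by a constant so as to vanish on the outer one.
  The constant disappears as \<open>R \<rightarrow> \<infinity>\<close>.
\<close>

lemma gap_lower_bound_at_infinity:
  assumes e: "norm e = 1" "r > 0" "dominates e r"
  obtains \<eta> where "\<eta> > 0" "\<And>y. norm (y - r *\<^sub>R e) \<ge> 2 * r \<Longrightarrow> \<eta> * newton_kernel (r *\<^sub>R e) y \<le> gap e r y"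
proof -
  obtain m where m: "m > 0" "\<And>y. norm (y - r *\<^sub>R e) = 2 * r \<Longrightarrow> m \<le> gap e r y"
    using gap_lower_bound_on_sphere[OF e] by blast
  define k where "k = (2 * r) powr (- (2 * a))"
  define \<eta> where "\<eta> = m / k"
  have k: "k > 0" using e(2) by (simp add: k_def)
  have \<eta>: "\<eta> > 0" using m k by (simp add: \<eta>_def)
  have "\<eta> * newton_kernel (r *\<^sub>R e) y \<le> gap e r y" if y: "norm (y - r *\<^sub>R e) \<ge> 2 * r" for y
  proof -
    have *: "- \<eta> * (R powr (- (2 * a))) + \<eta> * newton_kernel (r *\<^sub>R e) y \<le> gap e r y" if R: "R \<ge> norm (y - r *\<^sub>R e)" for R
    proof (rule gap_ge_barrier_on_annulus[OF e _ _ y R])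
      show "r \<le> 2 * r" using e(2) by simp
      fix x assume x: "norm (x - r *\<^sub>R e) = 2 * r \<or> norm (x - r *\<^sub>R e) = R"
      then show "- \<eta> * R powr - (2 * a) + \<eta> * newton_kernel (r *\<^sub>R e) x \<le> gap e r x"
      proof
        assume x: "norm (x - r *\<^sub>R e) = 2 * r"
        then have "x \<noteq> r *\<^sub>R e" using e(2) by auto
        then have "newton_kernel (r *\<^sub>R e) x = k" using x by (simp add: newton_kernel_eq_powr k_def)
        moreover have "\<eta> * k = m" using k by (simp add: \<eta>_def)
        moreover have "\<eta> * R powr - (2 * a) \<ge> 0" using \<eta> by simp
        ultimately show ?thesis using m(2)[OF x] by simp
      next
        assume x: "norm (x - r *\<^sub>R e) = R"
        then have "norm (x - r *\<^sub>R e) \<ge> r" using R y e(2) by simp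
        moreover from this have "x \<noteq> r *\<^sub>R e" using e(2) by auto
        ultimately show ?thesis using x e(3) by (simp add: newton_kernel_eq_powr dominates_def)
      qed
    qed
    have "((\<lambda>R. R powr (- (2 * a))) \<longlongrightarrow> 0) at_top"
      using a_pos by (intro tendsto_neg_powr filterlim_ident) auto
    then have "((\<lambda>R. - \<eta> * (R powr (- (2 * a))) + \<eta> * newton_kernel (r *\<^sub>R e) y) \<longlongrightarrow> - \<eta> * 0 + \<eta> * newton_kernel (r *\<^sub>R e) y) at_top"
      by (intro tendsto_intros)
    then have "- \<eta> * 0 + \<eta> * newton_kernel (r *\<^sub>R e) y \<le> gap e r y"
      by (rule tendsto_upperbound[OF _ eventually_mono[OF eventually_ge_at_top *]]) auto
    then show ?thesis by simp
  qed
  with \<eta> that show thesis by blast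
qed

text \<open>
  Near infinity the Kelvin transforms for radii near \<open>r\<close> behave like the Newton kernel with a
  coefficient close to \<open>r\<^sup>2\<^sup>a u(c)\<close>, since the inverted point tends to the centre. The surplus \<open>\<eta>\<close>
  of the previous bound survives a small change of the radius, uniformly in the point.
\<close>

lemma gap_pos_near_infinity:
  assumes e: "norm e = 1" "r > 0" "dominates e r"
  shows "\<forall>\<^sub>F (s, y) in nhds r \<times>\<^sub>F at_infinity. gap e s y > 0"
proof -
  define F where "F = (nhds r :: real filter) \<times>\<^sub>F (at_infinity :: 'a filter)"
  obtain \<eta> where \<eta>: "\<eta> > 0" "\<And>y. norm (y - r *\<^sub>R e) \<ge> 2 * r \<Longrightarrow> \<eta> * newton_kernel (r *\<^sub>R e) y \<le> gap e r y"
    using gap_lower_bound_at_infinity[OF e] by blast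
  have fst: "(fst \<longlongrightarrow> r) F"
    unfolding F_def by (rule filterlim_fst)
  have ninf: "filterlim (\<lambda>p. norm (snd p)) at_top F"
    unfolding F_def by (rule filterlim_compose[OF filterlim_norm_at_top filterlim_snd])
  have dinf: "filterlim (\<lambda>p. norm (snd p - f p *\<^sub>R e)) at_top F" if "(f \<longlongrightarrow> r) F" for f
  proof (rule filterlim_at_top_mono)
    have "((\<lambda>p. - \<bar>f p\<bar>) \<longlongrightarrow> - \<bar>r\<bar>) F"
      by (intro tendsto_minus tendsto_rabs that)
    then show "filterlim (\<lambda>p. - \<bar>f p\<bar> + norm (snd p)) at_top F"
      by (rule filterlim_tendsto_add_at_top[OF _ ninf])
    show "\<forall>\<^sub>F p in F. - \<bar>f p\<bar> + norm (snd p) \<le> norm (snd p - f p *\<^sub>R e)"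
    proof (rule always_eventually, rule allI)
      fix p
      have "norm (snd p) - norm (f p *\<^sub>R e) \<le> norm (snd p - f p *\<^sub>R e)"
        by (rule norm_triangle_ineq2)
      then show "- \<bar>f p\<bar> + norm (snd p) \<le> norm (snd p - f p *\<^sub>R e)"
        using e(1) by simp
    qed
  qed
  have z: "((\<lambda>p. sphere_inversion (f p) (f p *\<^sub>R e) (snd p)) \<longlongrightarrow> r *\<^sub>R e) F" if f: "(f \<longlongrightarrow> r) F" for f
  proof -
    have ev: "\<forall>\<^sub>F p in F. norm (snd p - f p *\<^sub>R e) > 0"
      using dinf[OF f] by (rule filterlim_at_top_dense[THEN iffD1, rule_format])
    have "((\<lambda>p. (f p)\<^sup>2 / norm (snd p - f p *\<^sub>R e)) \<longlongrightarrow> 0) F"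
      by (rule tendsto_divide_0[OF tendsto_power[OF f]]) (rule filterlim_at_top_imp_at_infinity[OF dinf[OF f]])
    moreover have "\<forall>\<^sub>F p in F. (f p)\<^sup>2 / norm (snd p - f p *\<^sub>R e) = norm (sphere_inversion (f p) (f p *\<^sub>R e) (snd p) - f p *\<^sub>R e)"
      using ev by eventually_elim (auto simp: dist_sphere_inversion_center)
    ultimately have "((\<lambda>p. norm (sphere_inversion (f p) (f p *\<^sub>R e) (snd p) - f p *\<^sub>R e)) \<longlongrightarrow> 0) F"
      by (rule Lim_transform_eventually)
    then have "((\<lambda>p. sphere_inversion (f p) (f p *\<^sub>R e) (snd p) - f p *\<^sub>R e) \<longlongrightarrow> 0) F"
      by (rule tendsto_norm_zero_cancel)
    moreover have "((\<lambda>p. f p *\<^sub>R e) \<longlongrightarrow> r *\<^sub>R e) F"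
      by (intro tendsto_intros f)
    ultimately have "((\<lambda>p. (sphere_inversion (f p) (f p *\<^sub>R e) (snd p) - f p *\<^sub>R e) + f p *\<^sub>R e) \<longlongrightarrow> 0 + r *\<^sub>R e) F"
      by (rule tendsto_add)
    then show ?thesis by simp
  qed
  define D where "D = (\<lambda>s (y::'a). norm (y - s *\<^sub>R e))"
  have ratio: "((\<lambda>p. D r (snd p) / D (fst p) (snd p)) \<longlongrightarrow> 1) F"
  proof -
    have "((\<lambda>p. \<bar>r - fst p\<bar> / D (fst p) (snd p)) \<longlongrightarrow> 0) F"
      unfolding D_def
      by (rule tendsto_divide_0[OF tendsto_rabs[OF tendsto_diff[OF tendsto_const fst]]
            filterlim_at_top_imp_at_infinity[OF dinf[OF fst]]])
    moreover have "\<forall>\<^sub>F p in F. norm (D r (snd p) / D (fst p) (snd p) - 1) \<le> \<bar>r - fst p\<bar> / D (fst p) (snd p)"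
      using dinf[OF fst, THEN filterlim_at_top_dense[THEN iffD1, rule_format, of _ _ 0]]
    proof eventually_elim
      case (elim p)
      have "\<bar>norm (snd p - r *\<^sub>R e) - norm (snd p - fst p *\<^sub>R e)\<bar> \<le> norm ((snd p - r *\<^sub>R e) - (snd p - fst p *\<^sub>R e))"
        by (rule norm_triangle_ineq3)
      also have "(snd p - r *\<^sub>R e) - (snd p - fst p *\<^sub>R e) = (fst p - r) *\<^sub>R e"
        by (simp add: algebra_simps)
      also have "norm \<dots> = \<bar>r - fst p\<bar>"
        using e(1) by simp
      finally have "\<bar>D r (snd p) - D (fst p) (snd p)\<bar> \<le> \<bar>r - fst p\<bar>"
        by (simp add: D_def)
      then have "\<bar>D r (snd p) - D (fst p) (snd p)\<bar> / D (fst p) (snd p) \<le> \<bar>r - fst p\<bar> / D (fst p) (snd p)"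
        using elim by (intro divide_right_mono) (auto simp: D_def)
      moreover have "D r (snd p) / D (fst p) (snd p) - 1 = (D r (snd p) - D (fst p) (snd p)) / D (fst p) (snd p)"
        using elim by (simp add: D_def field_simps)
      ultimately show ?case
        using elim by (simp add: abs_divide D_def)
    qed
    ultimately have "((\<lambda>p. D r (snd p) / D (fst p) (snd p) - 1) \<longlongrightarrow> 0) F"
      by (rule Lim_null_comparison[rotated])
    then show ?thesis by (rule LIM_zero_cancel)
  qed
  \<comment> \<open>\<open>u\<close> and its Kelvin transform for the new radius, both multiplied by \<open>|y - r e|\<^sup>2\<^sup>a\<close>;
      \<open>Lft\<close> is a lower bound for the former\<close>
  define Lft where "Lft = (\<lambda>p :: real \<times> 'a. \<eta> + r powr (2 * a) * u (sphere_inversion r (r *\<^sub>R e) (snd p)))"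
  define Rgt where "Rgt = (\<lambda>p :: real \<times> 'a. (D r (snd p) / D (fst p) (snd p)) powr (2 * a) * (fst p powr (2 * a) * u (sphere_inversion (fst p) (fst p *\<^sub>R e) (snd p))))"
  have "(Lft \<longlongrightarrow> \<eta> + r powr (2 * a) * u (r *\<^sub>R e)) F"
    unfolding Lft_def by (intro tendsto_intros has_laplacian_on_isCont_comp(1)[OF lap] z)
  moreover have "(Rgt \<longlongrightarrow> 1 powr (2 * a) * (r powr (2 * a) * u (r *\<^sub>R e))) F"
    unfolding Rgt_def using e(2)
    by (intro tendsto_mult tendsto_powr ratio fst tendsto_const has_laplacian_on_isCont_comp(1)[OF lap] z) auto
  ultimately have "((\<lambda>p. Lft p - Rgt p) \<longlongrightarrow> (\<eta> + r powr (2 * a) * u (r *\<^sub>R e)) - 1 powr (2 * a) * (r powr (2 * a) * u (r *\<^sub>R e))) F"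
    by (rule tendsto_diff)
  then have "\<forall>\<^sub>F p in F. Lft p - Rgt p > 0"
    by (rule order_tendstoD) (use \<eta>(1) in simp)
  moreover have "\<forall>\<^sub>F p in F. D r (snd p) > 2 * r"
    using filterlim_at_top_dense[THEN iffD1, rule_format, OF dinf[OF tendsto_const]] by (simp add: D_def)
  moreover have "\<forall>\<^sub>F p in F. D (fst p) (snd p) > 0"
    unfolding D_def by (rule filterlim_at_top_dense[THEN iffD1, rule_format, OF dinf[OF fst]])
  moreover have "\<forall>\<^sub>F p in F. fst p > 0"
    using fst e(2) by (rule order_tendstoD)
  ultimately have "\<forall>\<^sub>F p in F. gap e (fst p) (snd p) > 0"
  proof eventually_elim
    case (elim p)
    obtain s y where p: "p = (s, y)" by force
    have ds: "D r y > 0" "D s y > 0" "s > 0" using elim e(2) by (auto simp: p)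
    have ne: "y \<noteq> r *\<^sub>R e" "y \<noteq> s *\<^sub>R e" using ds by (auto simp: D_def)
    have K: "kelvin t (t *\<^sub>R e) u y = D t y powr (- (2 * a)) * (t powr (2 * a) * u (sphere_inversion t (t *\<^sub>R e) y))"
      if "t > 0" "D t y > 0" for t
    proof -
      have "((t / D t y)\<^sup>2) powr a = (t / D t y) powr (2 * a)"
        using that by (simp add: powr_powr[symmetric] powr_numeral)
      then show ?thesis
        using that by (simp add: kelvin_def inversion_factor_norm weight[symmetric] powr_divide powr_minus_divide D_def)
    qed
    have "\<eta> * newton_kernel (r *\<^sub>R e) y \<le> gap e r y"
      using \<eta>(2)[of y] elim by (simp add: D_def p)
    then have "D r y powr (- (2 * a)) * Lft p \<le> u y"
      using ds e(2) ne by (simp add: gap_def K newton_kernel_eq_powr Lft_def p D_def algebra_simps)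
    moreover have "D r y powr (- (2 * a)) * Rgt p < D r y powr (- (2 * a)) * Lft p"
      using elim ds by simp
    moreover have "D r y powr (- (2 * a)) * Rgt p = kelvin s (s *\<^sub>R e) u y"
      using ds by (simp add: K Rgt_def p powr_divide powr_minus_divide)
    ultimately show ?case by (simp add: p gap_def)
  qed
  then show ?thesis by (simp add: F_def case_prod_unfold)
qed

text \<open>
  If the inequality failed for radii arbitrarily close above \<open>r\<close>, the gaps for those radii would
  have negative minima. These stay in a bounded region by the bound near infinity, so they
  accumulate at a point where the gap for \<open>r\<close> is not positive and its gradient is zero. Strict
  positivity places that point on the boundary sphere, and the boundary point lemma excludes it
  there.
\<close>

lemma dominates_eventually_right:
  assumes e: "norm e = 1" "r > 0" "dominates e r"
  shows "\<exists>\<delta>>0. \<forall>s. r < s \<and> s < r + \<delta> \<longrightarrow> dominates e s"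
proof (rule ccontr)
  assume neg: "\<not> ?thesis"
  obtain P Q where P: "eventually P (nhds r)" and Q: "eventually Q (at_infinity :: 'a filter)"
    and PQ: "\<And>s y. P s \<Longrightarrow> Q y \<Longrightarrow> gap e s y > 0"
    using gap_pos_near_infinity[OF e] unfolding eventually_prod_filter by auto
  obtain R where R: "\<And>y. norm y \<ge> R \<Longrightarrow> Q y"
    using Q unfolding eventually_at_infinity by blast
  obtain d where d: "d > 0" "\<And>s. dist s r < d \<Longrightarrow> P s"
    using P unfolding eventually_nhds_metric by blast
  have "\<exists>s y. r < s \<and> s < r + inverse (real (Suc n)) \<and> (s < r + d \<longrightarrow> s < norm (y - s *\<^sub>R e) \<and> norm y < R \<and> gap e s y \<le> 0 \<and> gap_grad e s y = 0)" for n
  proof -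
    obtain s where s: "r < s" "s < r + inverse (real (Suc n))" "\<not> dominates e s"
      using neg by (metis inverse_positive_iff_positive of_nat_0_less_iff zero_less_Suc)
    have s0: "s > 0" using s e by simp
    have "\<exists>y. s < norm (y - s *\<^sub>R e) \<and> norm y < R \<and> gap e s y \<le> 0 \<and> gap_grad e s y = 0" if sd: "s < r + d"
    proof -
      have Ps: "P s" using d(2)[of s] s(1) sd by (simp add: dist_real_def)
      obtain y0 where y0: "norm (y0 - s *\<^sub>R e) \<ge> s" "gap e s y0 < 0"
        using s(3) by (auto simp: dominates_def not_le)
      define K where "K = cball 0 R - ball (s *\<^sub>R e) s"
      \<comment> \<open>the minimum over the part of the exterior inside the large ball is negative, hence it
          is attained neither on the sphere, where the gap is zero, nor on the large sphere\<close>
      have far: "norm y < R" if "gap e s y < 0" for y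
        using that PQ[OF Ps R, of y] by (meson less_asym not_le)
      have y0K: "y0 \<in> K"
        using y0 far[OF y0(2)] by (simp add: K_def dist_norm norm_minus_commute)
      have "compact K" unfolding K_def by (intro compact_diff compact_cball open_ball)
      moreover have "continuous_on K (gap e s)"
        using s0 by (intro continuous_on_gap) (auto simp: K_def)
      ultimately obtain y where y: "y \<in> K" "\<And>x. x \<in> K \<Longrightarrow> gap e s y \<le> gap e s x"
        using continuous_attains_inf y0K by (metis empty_iff)
      have neg: "gap e s y < 0" using y(2)[OF y0K] y0(2) by simp
      have "norm (y - s *\<^sub>R e) \<noteq> s" using gap_on_sphere[OF s0, of y e] neg by auto
      with y(1) have yS: "s < norm (y - s *\<^sub>R e)" by (simp add: K_def dist_norm norm_minus_commute)
      define S where "S = {y. s < norm (y - s *\<^sub>R e)} \<inter> {y. norm y < R}"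
      have "open S"
        unfolding S_def by (intro open_Int open_Collect_less continuous_intros)
      moreover have "S \<subseteq> - {s *\<^sub>R e}" using s0 by (auto simp: S_def)
      moreover have "y \<in> S" using yS far[OF neg] by (simp add: S_def)
      moreover have "gap e s y \<le> gap e s x" if "x \<in> S" for x
        using that by (intro y(2)) (auto simp: S_def K_def dist_norm norm_minus_commute)
      ultimately have "gap_grad e s y = 0"
        using has_laplacian_on_grad_zero_at_min[OF has_laplacian_on_subset[OF has_laplacian_on_gap[OF s0]]] by blast
      then show ?thesis using yS far[OF neg] neg by (intro exI[of _ y]) auto
    qed
    with s(1,2) show ?thesis by blast
  qed
  then obtain s y where s: "\<And>n. r < s n" "\<And>n. s n < r + inverse (real (Suc n))"
    and y: "\<And>n. s n < r + d \<Longrightarrow> s n < norm (y n - s n *\<^sub>R e) \<and> norm (y n) < R \<and> gap e (s n) (y n) \<le> 0 \<and> gap_grad e (s n) (y n) = 0"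
    by metis
  have "(\<lambda>n. r + inverse (real (Suc n))) \<longlonglongrightarrow> r + 0"
    by (intro tendsto_add tendsto_const LIMSEQ_inverse_real_of_nat)
  then have slim: "s \<longlonglongrightarrow> r"
    by (intro tendsto_sandwich[of "\<lambda>_. r" s sequentially "\<lambda>n. r + inverse (real (Suc n))" r]
        always_eventually allI less_imp_le s tendsto_const) (simp only: add_0_right)
  then have "\<forall>\<^sub>F n in sequentially. s n < r + d"
    using d(1) by (intro order_tendstoD) auto
  then obtain n0 where n0: "\<And>n. n \<ge> n0 \<Longrightarrow> s n < r + d"
    unfolding eventually_sequentially by blast
  define s' y' where "s' = (\<lambda>n. s (n + n0))" and "y' = (\<lambda>n. y (n + n0))"
  have y': "s' n < norm (y' n - s' n *\<^sub>R e)" "norm (y' n) < R" "gap e (s' n) (y' n) \<le> 0" "gap_grad e (s' n) (y' n) = 0" for n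
    using y[OF n0, of "n + n0"] by (auto simp: s'_def y'_def)
  have "bounded (range y')"
    using y'(2) by (auto simp: bounded_iff intro!: exI[of _ R] less_imp_le)
  then obtain x \<phi> where \<phi>: "strict_mono \<phi>" and x: "(y' \<circ> \<phi>) \<longlonglongrightarrow> x"
    using bounded_imp_convergent_subsequence by blast
  have "s' \<longlonglongrightarrow> r"
    unfolding s'_def using slim by (rule LIMSEQ_ignore_initial_segment)
  then have sl: "(s' \<circ> \<phi>) \<longlonglongrightarrow> r"
    using \<phi> by (rule LIMSEQ_subseq_LIMSEQ)
  have "(\<lambda>n. norm ((y' \<circ> \<phi>) n - (s' \<circ> \<phi>) n *\<^sub>R e)) \<longlonglongrightarrow> norm (x - r *\<^sub>R e)"
    by (intro tendsto_intros x sl)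
  from LIMSEQ_le[OF sl this] have xr: "r \<le> norm (x - r *\<^sub>R e)"
    using y'(1) by (auto intro: less_imp_le)
  then have xne: "x \<noteq> r *\<^sub>R e" using e(2) by auto
  have "gap e r x \<le> 0"
    by (rule LIMSEQ_le_const2[OF tendsto_gap(1)[OF sl x xne e(2)]]) (use y'(3) in auto)
  with gap_pos_outside[OF e, of x] xr have xs: "norm (x - r *\<^sub>R e) = r"
    by force
  have "(\<lambda>n. gap_grad e ((s' \<circ> \<phi>) n) ((y' \<circ> \<phi>) n)) \<longlonglongrightarrow> gap_grad e r x"
    by (rule tendsto_gap(2)[OF sl x xne e(2)])
  then have "(\<lambda>n. 0) \<longlonglongrightarrow> gap_grad e r x"
    by (simp add: y'(4))
  then have "gap_grad e r x = 0"
    by (simp add: LIMSEQ_const_iff)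
  with gap_grad_nonzero_on_sphere[OF e xs] show False by simp
qed

text \<open>
  In this form one sees that the balls increase with \<open>r\<close>, as all of them touch the origin.
\<close>

lemma outside_iff:
  assumes "norm e = 1" "r > 0"
  shows "norm (y - r *\<^sub>R e) \<ge> r \<longleftrightarrow> 2 * r * (y \<bullet> e) \<le> y \<bullet> y"
proof -
  have "norm (y - r *\<^sub>R e) \<ge> r \<longleftrightarrow> (norm (y - r *\<^sub>R e))\<^sup>2 \<ge> r\<^sup>2"
    using assms(2) by (metis abs_le_square_iff abs_norm_cancel abs_of_pos)
  also have "(norm (y - r *\<^sub>R e))\<^sup>2 = y \<bullet> y - 2 * r * (y \<bullet> e) + r\<^sup>2"
    using assms(1) by (simp add: power2_norm_eq_inner inner_diff_left inner_diff_right inner_commute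
        algebra_simps norm_eq_1) (simp add: power2_eq_square)
  finally show ?thesis by linarith
qed

text \<open>
  A point outside the ball of radius \<open>r\<close> is outside all smaller balls of the family.
\<close>

lemma dominates_closed:
  assumes "norm e = 1" "r > 0" "\<And>s. 0 < s \<Longrightarrow> s < r \<Longrightarrow> dominates e s"
  shows "dominates e r"
  unfolding dominates_def
proof (intro allI impI)
  fix y assume y: "r \<le> norm (y - r *\<^sub>R e)"
  have yne: "y \<noteq> r *\<^sub>R e" using y assms(2) by auto
  have "((\<lambda>s. gap e s y) \<longlongrightarrow> gap e r y) (at_left r)"
    by (rule tendsto_gap(1)[OF tendsto_ident_at tendsto_const yne assms(2)])
  moreover have "\<forall>\<^sub>F s in at_left r. gap e s y \<ge> 0"
    using eventually_at_left_real[OF assms(2)]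
  proof eventually_elim
    case (elim s)
    have "2 * s * (y \<bullet> e) \<le> y \<bullet> y"
    proof (cases "y \<bullet> e \<ge> 0")
      case True
      then have "2 * s * (y \<bullet> e) \<le> 2 * r * (y \<bullet> e)"
        using elim by (intro mult_right_mono) auto
      then show ?thesis using y outside_iff[OF assms(1,2), of y] by simp
    next
      case False
      then have "2 * s * (y \<bullet> e) \<le> 0" using elim by (intro mult_nonneg_nonpos) auto
      then show ?thesis by (meson inner_ge_zero order_trans)
    qed
    then show ?case
      using assms(3)[of s] outside_iff[OF assms(1), of s y] elim by (auto simp: dominates_def)
  qed
  ultimately show "0 \<le> gap e r y"
    by (rule tendsto_lowerbound) simp
qed

text \<open>
  Write \<open>y = c + t w\<close> with \<open>w\<close> a unit vector; the inverted point is \<open>c + \<sigma> w\<close> with \<open>\<sigma> t = r\<^sup>2\<close>,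
  and the claim reads \<open>\<sigma>\<^sup>a u(c + \<sigma> w) \<le> t\<^sup>a u(c + t w)\<close>. For \<open>t \<le> \<rho>\<close> it holds because
  \<open>t\<^sup>a u(c + t w)\<close> is increasing in \<open>t\<close> as long as \<open>t |\<nabla>u| \<le> a u\<close>. For \<open>t > \<rho>\<close> the Kelvin transform
  is at most a constant times \<open>(r / t)\<^sup>2\<^sup>a\<close>, which is beaten by the decay assumption when \<open>r\<close> is
  small.
\<close>

lemma dominates_small:
  assumes e: "norm e = 1"
  shows "\<exists>r0>0. \<forall>r. 0 < r \<and> r < r0 \<longrightarrow> dominates e r"
proof -
  obtain k where k: "k > 0" "\<And>x. k * (1 + (norm x)\<^sup>2) powr (- a) \<le> u x"
    using decay by blast
  have contu: "continuous_on (cball 0 1) u" and contG: "continuous_on (cball 0 1) G"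
    by (auto intro!: continuous_at_imp_continuous_on has_laplacian_on_imp_continuous[OF lap])
  have cball: "(0::'a) \<in> cball 0 1" by simp
  obtain x1 where "x1 \<in> cball 0 1" and x1: "\<And>x. x \<in> cball 0 1 \<Longrightarrow> u x1 \<le> u x"
    using continuous_attains_inf[OF compact_cball _ contu] cball by blast
  obtain x2 where "x2 \<in> cball 0 1" and x2: "\<And>x. x \<in> cball 0 1 \<Longrightarrow> u x \<le> u x2"
    using continuous_attains_sup[OF compact_cball _ contu] cball by blast
  have contnG: "continuous_on (cball 0 1) (\<lambda>x. norm (G x))"
    by (intro continuous_on_norm contG)
  obtain x3 where "x3 \<in> cball 0 1" and x3: "\<And>x. x \<in> cball 0 1 \<Longrightarrow> norm (G x) \<le> norm (G x3)"
    using continuous_attains_sup[OF compact_cball _ contnG] cball by blast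
  \<comment> \<open>below this distance \<open>t |\<nabla>u| \<le> a u\<close>; the bound \<open>1/2\<close> keeps all points in the unit ball\<close>
  define \<rho> where "\<rho> = min (1/2) (a * u x1 / (norm (G x3) + 1))"
  have den: "norm (G x3) + 1 > 0" by (simp add: add_nonneg_pos)
  have \<rho>: "\<rho> > 0" "\<rho> \<le> 1/2"
    using a_pos pos[of x1] den unfolding \<rho>_def by (simp_all only: min_less_iff_conj min.cobounded1) simp
  have \<rho>G: "\<rho> * norm (G x3) \<le> a * u x1"
  proof -
    have "\<rho> * (norm (G x3) + 1) \<le> a * u x1 / (norm (G x3) + 1) * (norm (G x3) + 1)"
      using den by (intro mult_right_mono) (auto simp: \<rho>_def)
    also have "\<dots> = a * u x1" using den by simp
    finally show ?thesis using \<rho>(1) by (simp add: algebra_simps)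
  qed
  \<comment> \<open>for \<open>t \<ge> \<rho>\<close> and \<open>|c| \<le> 1/2\<close> one has \<open>1 + |y|\<^sup>2 \<le> C t\<^sup>2\<close>\<close>
  define C where "C = 2 + (3/2) / \<rho>\<^sup>2"
  have C: "C > 0" using \<rho>(1) by (simp add: C_def add_pos_nonneg)
  define k' where "k' = k * C powr (- a) / u x2"
  have k': "k' > 0" using k C pos[of x2] by (simp add: k'_def)
  \<comment> \<open>this makes \<open>r\<^sup>2\<^sup>a \<le> k'\<close> for all \<open>r < r0\<close>\<close>
  define r0 where "r0 = min (1/2) (k' powr (1 / (2 * a)))"
  have r0: "r0 > 0" using k' by (simp add: r0_def)
  have "dominates e r" if r: "0 < r" "r < r0" for r
    unfolding dominates_def
  proof (intro allI impI)
    fix y assume out: "r \<le> norm (y - r *\<^sub>R e)"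
    define c t where "c = r *\<^sub>R e" and "t = norm (y - c)"
    have rhalf: "r < 1/2" using r by (simp add: r0_def)
    have nc: "norm c = r" using e r by (simp add: c_def)
    have t: "t \<ge> r" "t > 0" using out r by (auto simp: t_def c_def)
    have yc: "y \<noteq> c" using t(2) by (auto simp: t_def)
    define w where "w = (1 / t) *\<^sub>R (y - c)"
    have nw: "norm w = 1" using t by (simp add: w_def t_def)
    have yw: "y = c + t *\<^sub>R w" using t by (simp add: w_def)
    define \<sigma> where "\<sigma> = r\<^sup>2 / t"
    have \<sigma>: "\<sigma> > 0" "\<sigma> \<le> r" "\<sigma> \<le> t"
    proof -
      show "\<sigma> > 0" using r t by (simp add: \<sigma>_def)
      have "r * r \<le> r * t" using t r by (intro mult_left_mono) auto
      then show "\<sigma> \<le> r" using t by (simp add: \<sigma>_def power2_eq_square pos_divide_le_eq)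
      then show "\<sigma> \<le> t" using t by simp
    qed
    have z: "sphere_inversion r c y = c + \<sigma> *\<^sub>R w"
      using t by (simp add: sphere_inversion_def inversion_factor_norm \<sigma>_def w_def t_def[symmetric] power_divide power2_eq_square)
    have q: "inversion_factor r c y = \<sigma> / t"
      using t by (simp add: inversion_factor_norm t_def[symmetric] \<sigma>_def power_divide power2_eq_square)
    have inball: "c + x *\<^sub>R w \<in> cball 0 1" if "0 \<le> x" "x \<le> 1/2" for x
    proof -
      have "norm (c + x *\<^sub>R w) \<le> norm c + norm (x *\<^sub>R w)" by (rule norm_triangle_ineq)
      also have "\<dots> \<le> 1" using nc rhalf nw that by simp
      finally show ?thesis by simp
    qed
    have "(\<sigma> / t) powr a * u (c + \<sigma> *\<^sub>R w) \<le> u y"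
    proof (cases "t \<le> \<rho>")
      case True
      have "\<sigma> powr a * u (c + \<sigma> *\<^sub>R w) \<le> t powr a * u (c + t *\<^sub>R w)"
      proof (rule DERIV_nonneg_imp_nondecreasing[OF \<sigma>(3)])
        fix x assume x: "\<sigma> \<le> x" "x \<le> t"
        then have x0: "x > 0" "x \<le> \<rho>" using \<sigma> True by auto
        have inb: "c + x *\<^sub>R w \<in> cball 0 1" using x0 \<rho> by (intro inball) auto
        have "((\<lambda>x. c + x *\<^sub>R w) has_derivative (\<lambda>h. h *\<^sub>R w)) (at x)"
          by (auto intro!: derivative_eq_intros)
        moreover have "(u has_derivative (\<lambda>h. G (c + x *\<^sub>R w) \<bullet> h)) (at (c + x *\<^sub>R w))"
          using lap by (simp add: has_laplacian_on_def)
        ultimately have "((\<lambda>x. u (c + x *\<^sub>R w)) has_derivative (\<lambda>h. G (c + x *\<^sub>R w) \<bullet> (h *\<^sub>R w))) (at x)"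
          by (rule has_derivative_compose)
        then have ud: "((\<lambda>x. u (c + x *\<^sub>R w)) has_real_derivative (G (c + x *\<^sub>R w) \<bullet> w)) (at x)"
          unfolding has_field_derivative_def by (rule has_derivative_eq_rhs) auto
        have pd: "((\<lambda>x. x powr a) has_real_derivative (a * x powr (a - 1))) (at x)"
          using x0 by (intro has_real_derivative_powr) auto
        have "((\<lambda>x. x powr a * u (c + x *\<^sub>R w)) has_real_derivative
            (a * x powr (a - 1) * u (c + x *\<^sub>R w) + (G (c + x *\<^sub>R w) \<bullet> w) * x powr a)) (at x)"
          by (rule DERIV_mult[OF pd ud])
        moreover have "a * x powr (a - 1) * u (c + x *\<^sub>R w) + (G (c + x *\<^sub>R w) \<bullet> w) * x powr a \<ge> 0"
        proof -
          have "\<bar>G (c + x *\<^sub>R w) \<bullet> w\<bar> \<le> norm (G (c + x *\<^sub>R w)) * norm w"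
            by (rule Cauchy_Schwarz_ineq2)
          also have "\<dots> \<le> norm (G x3)" using x3[OF inb] nw by simp
          finally have "x * \<bar>G (c + x *\<^sub>R w) \<bullet> w\<bar> \<le> \<rho> * norm (G x3)"
            using x0 by (intro mult_mono) auto
          also have "\<dots> \<le> a * u x1" by (rule \<rho>G)
          also have "\<dots> \<le> a * u (c + x *\<^sub>R w)" using x1[OF inb] a_pos by simp
          finally have 1: "a * u (c + x *\<^sub>R w) + x * (G (c + x *\<^sub>R w) \<bullet> w) \<ge> 0"
            using x0 by (smt (verit) abs_ge_self abs_ge_minus_self minus_mult_right mult_left_mono)
          have "x powr a = x powr (a - 1) * x"
            using x0 powr_add[of x "a - 1" 1] by simp
          then have "a * x powr (a - 1) * u (c + x *\<^sub>R w) + (G (c + x *\<^sub>R w) \<bullet> w) * x powr a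
              = x powr (a - 1) * (a * u (c + x *\<^sub>R w) + x * (G (c + x *\<^sub>R w) \<bullet> w))"
            by (simp add: algebra_simps)
          then show ?thesis using 1 by simp
        qed
        ultimately show "\<exists>y. ((\<lambda>x. x powr a * u (c + x *\<^sub>R w)) has_real_derivative y) (at x) \<and> 0 \<le> y"
          by blast
      qed
      then show ?thesis
        using t \<sigma> yw by (simp add: powr_divide pos_divide_le_eq mult.commute)
    next
      case False
      then have t\<rho>: "t > \<rho>" by simp
      have "(\<sigma> / t) powr a = r powr (2 * a) * (t\<^sup>2) powr (- a)"
      proof -
        have "(r\<^sup>2) powr a = r powr (2 * a)" using r by (simp add: powr_powr[symmetric] powr_numeral)
        moreover have "\<sigma> / t = r\<^sup>2 / t\<^sup>2" by (simp add: \<sigma>_def power2_eq_square)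
        ultimately show ?thesis by (simp add: powr_divide powr_minus_divide)
      qed
      moreover have "u (c + \<sigma> *\<^sub>R w) \<le> u x2"
        using \<sigma> rhalf by (intro x2 inball) auto
      moreover have "r powr (2 * a) \<le> k'"
      proof -
        have "r powr (2 * a) \<le> (k' powr (1 / (2 * a))) powr (2 * a)"
          using r a_pos by (intro powr_mono2) (auto simp: r0_def)
        also have "\<dots> = k'" using a_pos k' by (simp add: powr_powr)
        finally show ?thesis .
      qed
      ultimately have "(\<sigma> / t) powr a * u (c + \<sigma> *\<^sub>R w) \<le> (k' * (t\<^sup>2) powr (- a)) * u x2"
        using pos[of "c + \<sigma> *\<^sub>R w"] k' by (intro mult_mono) (auto intro!: mult_right_mono)
      also have "\<dots> = k * (C * t\<^sup>2) powr (- a)"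
        using C t pos[of x2] by (simp add: k'_def powr_mult)
      also have "\<dots> \<le> k * (1 + (norm y)\<^sup>2) powr (- a)"
      proof -
        have "norm y \<le> norm c + norm (t *\<^sub>R w)" unfolding yw by (rule norm_triangle_ineq)
        then have "norm y \<le> 1/2 + t" using nc nw rhalf t by simp
        then have "(norm y)\<^sup>2 \<le> (1/2 + t)\<^sup>2" by (intro power_mono) auto
        also have "(1/2 + t)\<^sup>2 \<le> 2 * t\<^sup>2 + 1/2"
          using zero_le_power2[of "t - 1/2"] by (simp add: power2_eq_square algebra_simps)
        finally have "1 + (norm y)\<^sup>2 \<le> 2 * t\<^sup>2 + 3/2" by simp
        also have "3/2 \<le> (3/2) / \<rho>\<^sup>2 * t\<^sup>2"
          using \<rho>(1) t\<rho> power_mono[of \<rho> t 2] by (simp add: field_simps)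
        finally have "1 + (norm y)\<^sup>2 \<le> C * t\<^sup>2" by (simp add: C_def algebra_simps)
        moreover have "1 + (norm y)\<^sup>2 > 0" by (simp add: add_pos_nonneg)
        ultimately show ?thesis using k a_pos by (intro mult_left_mono powr_mono2') auto
      qed
      also have "\<dots> \<le> u y" by (rule k)
      finally show ?thesis .
    qed
    then show "0 \<le> gap e r y"
      unfolding gap_def kelvin_def using z q by (simp add: c_def weight)
  qed
  with r0 show ?thesis by blast
qed

text \<open>
  The infimum of the radii for which the inequality fails would be good by closedness, and by
  openness bad radii would then keep a positive distance from it.
\<close>

lemma dominates_all:
  assumes e: "norm e = 1" and r: "r > 0"
  shows "dominates e r"
proof (rule ccontr)
  assume neg: "\<not> dominates e r"
  define B where "B = {s. s > 0 \<and> \<not> dominates e s}"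
  obtain r0 where r0: "r0 > 0" "\<And>r. 0 < r \<Longrightarrow> r < r0 \<Longrightarrow> dominates e r"
    using dominates_small[OF e] by blast
  define m where "m = Inf B"
  have ne: "B \<noteq> {}" using neg r by (auto simp: B_def)
  have bdd: "bdd_below B" by (rule bdd_belowI[of _ 0]) (auto simp: B_def)
  have "r0 \<le> s" if "s \<in> B" for s
    using that r0(2)[of s] by (auto simp: B_def not_less[symmetric])
  then have "r0 \<le> m" unfolding m_def using ne by (intro cInf_greatest)
  with r0 have m: "m > 0" by simp
  have below: "dominates e s" if "0 < s" "s < m" for s
    using that cInf_lower[OF _ bdd, of s] by (force simp: B_def m_def)
  have dm: "dominates e m"
    by (rule dominates_closed[OF e m below])
  obtain \<delta> where \<delta>: "\<delta> > 0" "\<And>s. m < s \<Longrightarrow> s < m + \<delta> \<Longrightarrow> dominates e s"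
    using dominates_eventually_right[OF e m dm] by blast
  have "m + \<delta> \<le> s" if "s \<in> B" for s
    using that below[of s] dm \<delta>(2)[of s] by (force simp: B_def)
  then have "m + \<delta> \<le> m" using cInf_greatest[OF ne, of "m + \<delta>"] unfolding m_def[symmetric] by blast
  with \<delta>(1) show False by simp
qed

text \<open>
  As \<open>r \<rightarrow> \<infinity>\<close> the inversion in the sphere about \<open>r e\<close> through the origin tends to the reflection in
  the hyperplane orthogonal to \<open>e\<close>. The half-space \<open>y \<bullet> e \<le> 0\<close> lies outside all the balls.
\<close>

lemma reflection_le:
  assumes e: "norm e = 1" and y: "y \<bullet> e \<le> 0"
  shows "u (y - (2 * (y \<bullet> e)) *\<^sub>R e) \<le> u y"
proof -
  define p b where "p = y \<bullet> e" and "b = y \<bullet> y"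
  \<comment> \<open>\<open>m (1 / r) = |y - r e|\<^sup>2 / r\<^sup>2\<close>; in the variable \<open>1 / r\<close> all limits are values of
      rational functions at 0\<close>
  define m where "m = (\<lambda>t. 1 - 2 * p * t + b * t\<^sup>2)"
  have inv: "(inverse \<longlongrightarrow> (0::real)) at_top" by (rule tendsto_inverse_0_at_top[OF filterlim_ident])
  have m: "((\<lambda>r. m (inverse r)) \<longlongrightarrow> 1) at_top"
  proof -
    have "((\<lambda>r. m (inverse r)) \<longlongrightarrow> 1 - 2 * p * 0 + b * 0\<^sup>2) at_top"
      unfolding m_def by (intro tendsto_intros inv)
    then show ?thesis by simp
  qed
  have q: "((\<lambda>r. 1 / m (inverse r)) \<longlongrightarrow> 1 / 1) at_top"
    by (intro tendsto_intros m) simp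
  have z: "((\<lambda>r. ((b * inverse r - 2 * p) / m (inverse r)) *\<^sub>R e + (1 / m (inverse r)) *\<^sub>R y) \<longlongrightarrow> ((b * 0 - 2 * p) / 1) *\<^sub>R e + (1/1) *\<^sub>R y) at_top"
    by (intro tendsto_intros m inv) simp_all
  have "((\<lambda>r. (1 / m (inverse r)) powr a * u (((b * inverse r - 2 * p) / m (inverse r)) *\<^sub>R e + (1 / m (inverse r)) *\<^sub>R y))
     \<longlongrightarrow> (1/1) powr a * u (((b * 0 - 2 * p) / 1) *\<^sub>R e + (1/1) *\<^sub>R y)) at_top"
    by (intro tendsto_mult tendsto_powr q tendsto_const has_laplacian_on_isCont_comp(1)[OF lap] z) simp
  moreover have "\<forall>\<^sub>F r in at_top. (1 / m (inverse r)) powr a * u (((b * inverse r - 2 * p) / m (inverse r)) *\<^sub>R e + (1 / m (inverse r)) *\<^sub>R y) \<le> u y"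
    using eventually_gt_at_top[of 0]
  proof eventually_elim
    case (elim r)
    have out: "norm (y - r *\<^sub>R e) \<ge> r"
    proof -
      have "2 * r * (y \<bullet> e) \<le> 0" using elim y by (intro mult_nonneg_nonpos) auto
      then have "2 * r * (y \<bullet> e) \<le> y \<bullet> y" by (meson inner_ge_zero order_trans)
      then show ?thesis using outside_iff[OF e elim] by blast
    qed
    define s where "s = (y - r *\<^sub>R e) \<bullet> (y - r *\<^sub>R e)"
    have s: "s = b - 2 * r * p + r\<^sup>2"
      using e by (simp add: s_def inner_diff_left inner_diff_right inner_commute norm_eq_1 b_def p_def)
         (simp add: power2_eq_square inner_commute)
    have s0: "s > 0" using out elim by (auto simp: s_def)
    have ms: "m (inverse r) = s / r\<^sup>2"
      using elim by (simp add: m_def s field_simps power2_eq_square)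
    have qq: "inversion_factor r (r *\<^sub>R e) y = 1 / m (inverse r)"
      by (simp add: inversion_factor_def ms s_def)
    have "r * (1 - r\<^sup>2 / s) = (b * inverse r - 2 * p) / m (inverse r)"
    proof -
      have "r * (1 - r\<^sup>2 / s) * s = r * (s - r\<^sup>2)"
        using s0 by (simp add: field_simps)
      also have "\<dots> = (b * inverse r - 2 * p) * r\<^sup>2"
        using elim unfolding s by (simp add: power2_eq_square algebra_simps)
      finally have "r * (1 - r\<^sup>2 / s) = (b * inverse r - 2 * p) * r\<^sup>2 / s"
        using s0 by (simp add: eq_divide_eq)
      then show ?thesis
        using elim s0 by (simp add: ms)
    qed
    then have "sphere_inversion r (r *\<^sub>R e) y = ((b * inverse r - 2 * p) / m (inverse r)) *\<^sub>R e + (1 / m (inverse r)) *\<^sub>R y"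
    proof -
      define Q where "Q = 1 / m (inverse r)"
      have "Q = r\<^sup>2 / s" by (simp add: Q_def ms)
      with \<open>r * (1 - r\<^sup>2 / s) = _\<close> have X: "(b * inverse r - 2 * p) / m (inverse r) = r * (1 - Q)"
        by simp
      show ?thesis
        unfolding sphere_inversion_def qq X Q_def[symmetric] by (simp add: algebra_simps)
    qed
    moreover have "kelvin r (r *\<^sub>R e) u y \<le> u y"
      using dominates_all[OF e elim] out by (simp add: dominates_def gap_def)
    ultimately show ?case by (simp add: kelvin_def qq weight)
  qed
  ultimately have "(1/1) powr a * u (((b * 0 - 2 * p) / 1) *\<^sub>R e + (1/1) *\<^sub>R y) \<le> u y"
    by (rule tendsto_upperbound) simp
  then show ?thesis by (simp add: p_def algebra_simps)
qed

text \<open>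
  The reflection along \<open>y - x\<close> takes \<open>x\<close> to \<open>y\<close>, and \<open>x\<close> lies on its negative side.
\<close>

theorem radial:
  assumes "norm x = norm y"
  shows "u x = u y"
proof -
  have le: "u y \<le> u x" if n: "norm x = norm y" "x \<noteq> y" for x y
  proof -
    define e where "e = (1 / norm (y - x)) *\<^sub>R (y - x)"
    define d where "d = norm (y - x)"
    have d: "d > 0" using n by (simp add: d_def)
    have e: "norm e = 1" using n by (simp add: e_def)
    have "y \<bullet> y = x \<bullet> x" using n(1) by (simp add: dot_square_norm)
    then have "d\<^sup>2 = - 2 * (x \<bullet> (y - x))"
      by (simp add: d_def power2_norm_eq_inner inner_diff_left inner_diff_right inner_commute)
    then have xe: "x \<bullet> e = - d / 2"
      using d unfolding e_def d_def[symmetric] inner_scaleR_right by (simp add: power2_eq_square field_simps)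
    have "x - (2 * (x \<bullet> e)) *\<^sub>R e = y"
      using d by (simp add: xe) (simp add: e_def d_def[symmetric])
    then show ?thesis using reflection_le[OF e, of x] xe d by simp
  qed
  show ?thesis
    using le[of x y] le[of y x] assms by fastforce
qed

end

section \<open>Stereographic coordinates\<close>

lemma partial_deriv_eq:
  assumes "(f has_derivative f') (at x)"
  shows "partial_deriv i f x = f' (axis i 1)"
proof -
  have l: "((\<lambda>t. x + t *\<^sub>R axis i 1) has_derivative (\<lambda>t. t *\<^sub>R axis i 1)) (at 0)"
    by (auto intro!: derivative_eq_intros)
  have "(f has_derivative f') (at (x + 0 *\<^sub>R axis i 1))"
    using assms by simp
  from has_derivative_compose[OF l this]
  have "((\<lambda>t. f (x + t *\<^sub>R axis i 1)) has_vector_derivative f' (axis i 1)) (at 0)"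
    unfolding has_vector_derivative_def
    by (simp add: linear_cmul[OF has_derivative_linear[OF assms]])
  then show ?thesis
    unfolding partial_deriv_def by (rule vector_derivative_at)
qed

lemma sum_Basis_eq_sum_axis: "(\<Sum>b\<in>(Basis :: (real ^ 'n) set). f b) = (\<Sum>i\<in>UNIV. f (axis i (1::real)))"
proof -
  have B: "(Basis :: (real ^ 'n) set) = range (\<lambda>i. axis i 1)"
    by (auto simp: Basis_vec_def)
  have I: "inj (\<lambda>i::'n. axis i (1::real))"
    by (auto simp: inj_def axis_eq_axis)
  show ?thesis
    unfolding B by (simp only: sum.reindex[OF I] o_def)
qed

lemma has_divergence_eq_sum_partial_deriv:
  fixes F :: "real ^ 'n \<Rightarrow> real ^ 'n"
  assumes "has_divergence F l x"
  shows "(\<Sum>i\<in>UNIV. partial_deriv i (\<lambda>y. F y $ i) x) = l"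
proof -
  obtain L where L: "(F has_derivative L) (at x)" "(\<Sum>b\<in>Basis. L b \<bullet> b) = l"
    using assms by (auto simp: has_divergence_def)
  have "partial_deriv i (\<lambda>y. F y $ i) x = L (axis i 1) \<bullet> axis i 1" for i
    using partial_deriv_eq[OF bounded_linear.has_derivative[OF bounded_linear_vec_nth L(1)], of i i]
    by (simp add: inner_axis)
  then show ?thesis
    using L(2) by (simp add: sum_Basis_eq_sum_axis)
qed

definition conf_factor :: "'a::real_inner \<Rightarrow> real" where
  "conf_factor x = 2 / ((norm x)\<^sup>2 + 1)"

lemma conf_factor_pos: "conf_factor x > 0"
  by (simp add: conf_factor_def add_nonneg_pos)

lemma conf_factor_times_norm_square: "conf_factor x * (norm x)\<^sup>2 = 2 - conf_factor x"
proof -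
  have "(norm x)\<^sup>2 + 1 \<noteq> 0" by (simp add: add_nonneg_pos order.strict_implies_not_eq[symmetric])
  then show ?thesis by (simp add: conf_factor_def field_simps)
qed

lemma inv_stereographic_conf_factor:
  "inv_stereographic x = (conf_factor x *\<^sub>R x, 1 - conf_factor x)"
proof -
  have "(norm x)\<^sup>2 + 1 \<noteq> 0" by (simp add: add_nonneg_pos order.strict_implies_not_eq[symmetric])
  then show ?thesis by (simp add: inv_stereographic_def conf_factor_def field_simps)
qed

lemma has_derivative_conf_factor:
  "(conf_factor has_derivative (\<lambda>h. - (conf_factor x)\<^sup>2 * (x \<bullet> h))) (at x)"
proof -
  have "(norm x)\<^sup>2 + 1 > 0" by (simp add: add_nonneg_pos)
  then have "x \<bullet> x + 1 > 0" by (simp add: power2_norm_eq_inner)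
  then show ?thesis
    unfolding conf_factor_def power2_norm_eq_inner
    by (auto intro!: derivative_eq_intros simp: inner_commute power2_eq_square divide_simps)
qed

lemma has_derivative_conf_factor_powr:
  "((\<lambda>x. conf_factor x powr b) has_derivative (\<lambda>h. - b * conf_factor x powr (b + 1) * (x \<bullet> h))) (at x)"
proof -
  have "conf_factor x powr (b + 1) = conf_factor x powr b * conf_factor x"
    using conf_factor_pos[of x] by (simp add: powr_add)
  then show ?thesis
    using conf_factor_pos[of x]
    by (intro has_derivative_eq_rhs[OF has_derivative_powr[OF has_derivative_conf_factor has_derivative_const conf_factor_pos UNIV_I]])
       (auto simp: fun_eq_iff power2_eq_square)
qed

lemma has_derivative_inv_stereographic:
  "(inv_stereographic has_derivative
     (\<lambda>h. (conf_factor x *\<^sub>R h - ((conf_factor x)\<^sup>2 * (x \<bullet> h)) *\<^sub>R x, (conf_factor x)\<^sup>2 * (x \<bullet> h)))) (at x)"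
  unfolding inv_stereographic_conf_factor[abs_def]
  by (rule has_derivative_eq_rhs, (rule has_derivative_Pair has_derivative_scaleR has_derivative_diff
        has_derivative_conf_factor has_derivative_ident has_derivative_const)+) auto

text \<open>
  Stereographic projection is conformal with factor \<open>\<phi> = conf_factor\<close>. Off the diagonal everything
  cancels by \<open>\<phi> |x|\<^sup>2 = 2 - \<phi>\<close>.
\<close>

lemma induced_metric_inv_stereographic:
  "induced_metric inv_stereographic x = (\<chi> i j. if i = j then (conf_factor x)\<^sup>2 else 0)"
proof -
  define p where "p = conf_factor x"
  have n: "x \<bullet> x * p = 2 - p"
    using conf_factor_times_norm_square[of x] by (simp add: p_def power2_norm_eq_inner mult.commute)
  have "partial_deriv i inv_stereographic x \<bullet> partial_deriv j inv_stereographic x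
      = (if i = j then p\<^sup>2 else 0)" for i j
  proof -
    define xi xj where "xi = x $ i" and "xj = x $ j"
    have d: "partial_deriv k inv_stereographic x = (p *\<^sub>R axis k 1 - (p\<^sup>2 * x $ k) *\<^sub>R x, p\<^sup>2 * x $ k)" for k
      by (simp add: partial_deriv_eq[OF has_derivative_inv_stereographic] p_def inner_axis)
    have ax: "axis i 1 \<bullet> axis j (1::real) = (if i = j then 1 else 0)"
      by (simp add: inner_axis_axis)
    have "partial_deriv i inv_stereographic x \<bullet> partial_deriv j inv_stereographic x
      = p\<^sup>2 * (axis i 1 \<bullet> axis j (1::real)) - 2 * p ^ 3 * xi * xj + p ^ 3 * xi * xj * (x \<bullet> x * p) + p ^ 4 * xi * xj"
      by (simp add: d inner_Pair inner_diff_left inner_diff_right inner_axis inner_axis' xi_def xj_def)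
         (simp add: algebra_simps eval_nat_numeral)
    also have "\<dots> = p\<^sup>2 * (axis i 1 \<bullet> axis j (1::real))"
      by (simp add: n) (simp add: algebra_simps eval_nat_numeral)
    finally show ?thesis by (simp add: ax)
  qed
  then show ?thesis
    by (simp add: induced_metric_def p_def vec_eq_iff)
qed

lemma det_induced_metric:
  "sqrt (det (induced_metric inv_stereographic (x :: real ^ 'n))) = conf_factor x ^ CARD('n)"
proof -
  have "det (induced_metric inv_stereographic x) = (\<Prod>i\<in>(UNIV::'n set). (conf_factor x)\<^sup>2)"
    by (subst det_diagonal) (auto simp: induced_metric_inv_stereographic)
  also have "\<dots> = (conf_factor x ^ CARD('n))\<^sup>2"
    by (simp add: power_mult[symmetric] mult.commute)
  finally show ?thesis
    using conf_factor_pos[of x] by (simp add: real_sqrt_abs less_imp_le)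
qed

lemma matrix_inv_induced_metric:
  "matrix_inv (induced_metric inv_stereographic (x :: real ^ 'n)) =
    (\<chi> i j. if i = j then 1 / (conf_factor x)\<^sup>2 else 0)" (is "matrix_inv ?A = ?B")
proof -
  have p: "(conf_factor x)\<^sup>2 \<noteq> 0" using conf_factor_pos[of x] by simp
  have AB: "?A ** ?B = mat 1" "?B ** ?A = mat 1"
    using p by (auto simp: induced_metric_inv_stereographic matrix_matrix_mult_def vec_eq_iff mat_def if_distrib[of "\<lambda>z. _ * z"] if_distrib[of "\<lambda>z. z * _"] cong: if_cong)
  have "?A ** matrix_inv ?A = mat 1 \<and> matrix_inv ?A ** ?A = mat 1"
    unfolding matrix_inv_def by (rule someI[where P = "\<lambda>B. ?A ** B = mat 1 \<and> B ** ?A = mat 1" and x = ?B]) (simp add: AB)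
  then have "matrix_inv ?A = (matrix_inv ?A ** ?A) ** ?B"
    using AB by (metis matrix_mul_assoc matrix_mul_rid)
  also have "\<dots> = ?B"
    using \<open>_ \<and> matrix_inv ?A ** ?A = mat 1\<close> by simp
  finally show ?thesis .
qed

text \<open>
  For the metric \<open>\<phi>\<^sup>2 \<delta>\<^sub>i\<^sub>j\<close> the flux in the definition of the Laplace-Beltrami operator is
  \<open>\<phi>\<^sup>n\<^sup>-\<^sup>2 \<nabla>V\<close>, so the operator is a weighted divergence of the flat gradient.
\<close>

lemma laplace_beltrami_stereographic:
  fixes V :: "real ^ 'n \<Rightarrow> real"
  assumes lap: "has_laplacian_on V G \<Delta> UNIV" and dim: "CARD('n) \<ge> 2"
  shows "laplace_beltrami_coord (induced_metric inv_stereographic) V x =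
    \<Delta> x / (conf_factor x)\<^sup>2 - (real CARD('n) - 2) * (x \<bullet> G x) / conf_factor x"
proof -
  define b where "b = real CARD('n) - 2"
  define p where "p = conf_factor x"
  have p: "p > 0" by (simp add: p_def conf_factor_pos)
  have V: "(V has_derivative (\<lambda>h. G y \<bullet> h)) (at y)" and G: "has_divergence G (\<Delta> y) y" for y
    using lap by (auto simp: has_laplacian_on_def)
  have N: "conf_factor y ^ CARD('n) = conf_factor y powr b * (conf_factor y)\<^sup>2" for y :: "real ^ 'n"
    using conf_factor_pos[of y] by (simp add: b_def powr_diff powr_realpow)
  have flux: "sqrt (det (induced_metric inv_stereographic y)) *
        (\<Sum>j\<in>UNIV. matrix_inv (induced_metric inv_stereographic y) $ i $ j * partial_deriv j V y)
      = (conf_factor y powr b *\<^sub>R G y) $ i" for i and y :: "real ^ 'n"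
  proof -
    have "(\<Sum>j\<in>UNIV. matrix_inv (induced_metric inv_stereographic y) $ i $ j * partial_deriv j V y)
        = (\<Sum>j\<in>UNIV. if i = j then partial_deriv j V y / (conf_factor y)\<^sup>2 else 0)"
      by (intro sum.cong) (auto simp: matrix_inv_induced_metric)
    also have "\<dots> = G y $ i / (conf_factor y)\<^sup>2"
      by (simp add: partial_deriv_eq[OF V] inner_axis)
    finally show ?thesis
      using conf_factor_pos[of y] by (simp add: det_induced_metric N)
  qed
  have "has_divergence (\<lambda>y. conf_factor y powr b *\<^sub>R G y)
      (p powr b * \<Delta> x + - b * p powr (b + 1) * (x \<bullet> G x)) x"
    unfolding p_def by (rule has_divergence_scaleR[OF has_derivative_conf_factor_powr G])
  from has_divergence_eq_sum_partial_deriv[OF this]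
  have "laplace_beltrami_coord (induced_metric inv_stereographic) V x
      = 1 / p ^ CARD('n) * (p powr b * \<Delta> x + - b * p powr (b + 1) * (x \<bullet> G x))"
    unfolding laplace_beltrami_coord_def flux by (simp add: det_induced_metric p_def)
  also have "\<dots> = \<Delta> x / p\<^sup>2 - b * (x \<bullet> G x) / p"
    using p by (simp add: N[of x, folded p_def] powr_add field_simps power2_eq_square)
  finally show ?thesis by (simp add: b_def p_def)
qed

text \<open>
  Conformal covariance of the conformal Laplacian for stereographic projection. The rescaling
  removes the first-order term of the Laplace-Beltrami operator, and the zeroth-order term
  \<open>a (a + 1) = n (n - 2) / 4\<close> is what the Laplacian of \<open>\<phi>\<^sup>a\<close> contributes.
\<close>

lemma has_laplacian_on_conformal_rescaling:
  fixes V :: "real ^ 'n \<Rightarrow> real"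
  defines "a \<equiv> conformal_weight TYPE(real ^ 'n)"
  assumes lap: "has_laplacian_on V G \<Delta> UNIV"
  shows "has_laplacian_on (\<lambda>x. conf_factor x powr a * V x)
    (\<lambda>x. conf_factor x powr a *\<^sub>R G x - (a * (conf_factor x powr (a + 1) * V x)) *\<^sub>R (x - 0))
    (\<lambda>x. conf_factor x powr (a + 2) *
       (\<Delta> x / (conf_factor x)\<^sup>2 - 2 * a * (x \<bullet> G x) / conf_factor x - a * (a + 1) * V x)) UNIV"
  unfolding has_laplacian_on_def
proof (intro ballI conjI)
  fix x :: "real ^ 'n"
  define p A where "p = conf_factor x" and "A = p powr a"
  have p: "p > 0" by (simp add: p_def conf_factor_pos)
  have pn: "p * (x \<bullet> x) = 2 - p"
    using conf_factor_times_norm_square[of x] by (simp add: p_def power2_norm_eq_inner)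
  have p1: "p powr (a + 1) = A * p" and p2: "p powr (a + 2) = A * p * p" and p11: "p powr (a + 1 + 1) = A * p * p"
    using p by (simp_all add: A_def powr_add power2_eq_square)
  have N: "real DIM(real ^ 'n) = 2 * a + 2"
    by (simp add: a_def conformal_weight_def field_simps)
  have V: "(V has_derivative (\<lambda>h. G x \<bullet> h)) (at x)" and G: "has_divergence G (\<Delta> x) x"
    using lap by (auto simp: has_laplacian_on_def)
  note P = has_derivative_conf_factor_powr[where x = x, folded p_def]
  show "((\<lambda>x. conf_factor x powr a * V x) has_derivative
      (\<lambda>h. (conf_factor x powr a *\<^sub>R G x - (a * (conf_factor x powr (a + 1) * V x)) *\<^sub>R (x - 0)) \<bullet> h)) (at x)"
    by (rule has_derivative_eq_rhs[OF has_derivative_mult[OF P V]])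
       (auto simp: p_def[symmetric] inner_diff_left algebra_simps)
  have m: "((\<lambda>x. a * (conf_factor x powr (a + 1) * V x)) has_derivative
      (\<lambda>h. a * (p powr (a + 1) * (G x \<bullet> h) + - (a + 1) * p powr (a + 1 + 1) * (x \<bullet> h) * V x))) (at x)"
    using has_derivative_mult_right[OF has_derivative_mult[OF P[of "a + 1"] V], of a] by (simp only: p_def)
  have "has_divergence (\<lambda>x. conf_factor x powr a *\<^sub>R G x - (a * (conf_factor x powr (a + 1) * V x)) *\<^sub>R (x - 0))
     ((p powr a * \<Delta> x + - a * p powr (a + 1) * (x \<bullet> G x)) -
      (a * (p powr (a + 1) * V x) * (2 * a + 2) +
       a * (p powr (a + 1) * (G x \<bullet> (x - 0)) + - (a + 1) * p powr (a + 1 + 1) * (x \<bullet> (x - 0)) * V x))) x"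
    using has_divergence_diff[OF has_divergence_scaleR[OF P G] has_divergence_scaleR[OF m has_divergence_position[of 0]]]
    unfolding N by (simp only: p_def)
  moreover have "(p powr a * \<Delta> x + - a * p powr (a + 1) * (x \<bullet> G x)) -
      (a * (p powr (a + 1) * V x) * (2 * a + 2) +
       a * (p powr (a + 1) * (G x \<bullet> (x - 0)) + - (a + 1) * p powr (a + 1 + 1) * (x \<bullet> (x - 0)) * V x))
     = p powr (a + 2) * (\<Delta> x / p\<^sup>2 - 2 * a * (x \<bullet> G x) / p - a * (a + 1) * V x)" (is "?l = ?r")
  proof -
    have "?l = A * \<Delta> x - 2 * a * A * p * (x \<bullet> G x) - a * (A * p * V x) * (2 * a + 2)
        + a * (a + 1) * A * p * V x * (p * (x \<bullet> x))"
      unfolding p1 p11 A_def[symmetric] by (simp add: inner_commute[of "G x"] algebra_simps)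
    also have "\<dots> = A * \<Delta> x - 2 * a * A * p * (x \<bullet> G x) - a * (a + 1) * A * p * p * V x"
      unfolding pn by (simp add: algebra_simps)
    also have "\<dots> = ?r"
      using p unfolding p2 by (simp add: field_simps power2_eq_square)
    finally show ?thesis .
  qed
  ultimately show "has_divergence (\<lambda>x. conf_factor x powr a *\<^sub>R G x - (a * (conf_factor x powr (a + 1) * V x)) *\<^sub>R (x - 0))
    (conf_factor x powr (a + 2) *
       (\<Delta> x / (conf_factor x)\<^sup>2 - 2 * a * (x \<bullet> G x) / conf_factor x - a * (a + 1) * V x)) x"
    by (simp only: p_def)
qed

lemma C2_on_imp_has_laplacian_on:
  fixes V :: "'a::euclidean_space \<Rightarrow> real"
  assumes "C2_on S V"
  obtains G \<Delta> where "has_laplacian_on V G \<Delta> S"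
proof -
  obtain f' :: "'a \<Rightarrow> 'a \<Rightarrow>\<^sub>L real" and f'' :: "'a \<Rightarrow> 'a \<Rightarrow>\<^sub>L 'a \<Rightarrow>\<^sub>L real" where
    f: "\<And>x. x \<in> S \<Longrightarrow> (V has_derivative blinfun_apply (f' x)) (at x)"
       "\<And>x. x \<in> S \<Longrightarrow> (f' has_derivative blinfun_apply (f'' x)) (at x)"
    using assms unfolding C2_on_def by blast
  define G where "G = (\<lambda>x. \<Sum>b\<in>Basis. blinfun_apply (f' x) b *\<^sub>R b)"
  define L where "L = (\<lambda>x h. \<Sum>b\<in>Basis. blinfun_apply (blinfun_apply (f'' x) h) b *\<^sub>R b)"
  have G: "G x \<bullet> h = blinfun_apply (f' x) h" for x h
    using linear_sum_inner_Basis[OF bounded_linear.linear[OF blinfun.bounded_linear_right], of "f' x" h]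
    by (simp add: G_def inner_sum_left inner_commute[of h])
  then have G: "(\<bullet>) (G x) = blinfun_apply (f' x)" for x
    by (intro ext)
  have "(G has_derivative L x) (at x)" if "x \<in> S" for x
    unfolding G_def L_def
    by (intro has_derivative_sum has_derivative_scaleR_left)
       (use f(2)[OF that] in \<open>auto intro: bounded_linear.has_derivative[OF blinfun.bounded_linear_left]\<close>)
  then have "has_laplacian_on V G (\<lambda>x. \<Sum>b\<in>Basis. L x b \<bullet> b) S"
    unfolding has_laplacian_on_def has_divergence_def
    using f(1) by (simp add: G) blast
  then show thesis by (rule that)
qed

lemma inv_stereographic_tendsto_north_pole:
  "((inv_stereographic :: real ^ 'n \<Rightarrow> _) \<longlongrightarrow> north_pole) at_infinity"
proof -
  have n: "filterlim (\<lambda>x :: real ^ 'n. norm x) at_top at_infinity"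
    by (rule filterlim_norm_at_top)
  have "((\<lambda>x :: real ^ 'n. 2 / (1 + (norm x)\<^sup>2)) \<longlongrightarrow> 0) at_infinity"
    by (intro tendsto_divide_0[OF tendsto_const] filterlim_at_top_imp_at_infinity
        filterlim_tendsto_add_at_top[OF tendsto_const] filterlim_pow_at_top n) simp
  then have p: "((conf_factor :: real ^ 'n \<Rightarrow> real) \<longlongrightarrow> 0) at_infinity"
    by (simp add: conf_factor_def[abs_def] add.commute)
  have "norm (conf_factor x *\<^sub>R x) = sqrt (conf_factor x * (2 - conf_factor x))" for x :: "real ^ 'n"
  proof -
    have "(norm (conf_factor x *\<^sub>R x))\<^sup>2 = conf_factor x * (conf_factor x * (norm x)\<^sup>2)"
      by (simp add: power_mult_distrib power2_eq_square)
    then show ?thesis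
      by (metis conf_factor_times_norm_square norm_ge_zero real_sqrt_unique)
  qed
  moreover have "((\<lambda>x :: real ^ 'n. sqrt (conf_factor x * (2 - conf_factor x))) \<longlongrightarrow> sqrt (0 * (2 - 0))) at_infinity"
    by (intro tendsto_intros p)
  ultimately have "((\<lambda>x :: real ^ 'n. conf_factor x *\<^sub>R x) \<longlongrightarrow> 0) at_infinity"
    by (intro tendsto_norm_zero_cancel[of "\<lambda>x. conf_factor x *\<^sub>R x"]) simp
  moreover have "((\<lambda>x :: real ^ 'n. 1 - conf_factor x) \<longlongrightarrow> 1 - 0) at_infinity"
    by (intro tendsto_intros p)
  ultimately show ?thesis
    unfolding inv_stereographic_conf_factor[abs_def] north_pole_def by (auto intro: tendsto_Pair)
qed

lemma inv_stereographic_in: "inv_stereographic x \<in> unit_sphere - {north_pole}"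
  using bij_betwE[OF inv_stereographic_bij] by blast

lemma stereographic_inv_stereographic: "stereographic (inv_stereographic x) = x"
  using conf_factor_pos[of x] by (simp add: stereographic_def inv_stereographic_conf_factor)

lemma inv_stereographic_stereographic:
  assumes "\<theta> \<in> unit_sphere - {north_pole}"
  shows "inv_stereographic (stereographic \<theta>) = \<theta>"
proof -
  obtain x where "\<theta> = inv_stereographic x"
    using assms inv_stereographic_bij by (metis bij_betw_imp_surj_on imageE)
  then show ?thesis by (simp add: stereographic_inv_stereographic)
qed

lemma inv_stereographic_ne_south_pole: "x \<noteq> 0 \<Longrightarrow> inv_stereographic x \<noteq> south_pole"
  using conf_factor_pos[of x] by (simp add: inv_stereographic_conf_factor south_pole_def)

text \<open>
  Rotations act transitively on the vectors of a given norm, so a rotationally symmetric function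
  on the sphere depends in the chart on the norm only.
\<close>

lemma rot_symmetric_on_imp_eq:
  fixes f :: "(real ^ 'n) \<times> real \<Rightarrow> real"
  assumes rot: "rot_symmetric_on (unit_sphere - {north_pole}) f" and dim: "CARD('n) \<ge> 2" and n: "norm x = norm y"
  shows "f (inv_stereographic x) = f (inv_stereographic y)"
proof -
  obtain h where h: "orthogonal_transformation h" "det (matrix h) = 1" "h x = y"
    using rotation_exists[OF dim n] by blast
  have lin: "linear h" using h(1) by (simp add: orthogonal_transformation_def)
  have "rotation_matrix (matrix h)"
    using h by (simp add: rotation_matrix_def orthogonal_transformation_matrix)
  moreover have p: "conf_factor x = conf_factor y" by (simp add: conf_factor_def n)
  ultimately have "f (matrix h *v (conf_factor x *\<^sub>R x), 1 - conf_factor x) = f (conf_factor x *\<^sub>R x, 1 - conf_factor x)"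
    using rot inv_stereographic_in[of x] by (simp add: rot_symmetric_on_def inv_stereographic_conf_factor)
  moreover have "matrix h *v (conf_factor x *\<^sub>R x) = conf_factor y *\<^sub>R y"
    by (simp add: matrix_works[OF lin[unfolded linear_matrix_vector_mul_eq[symmetric]]] linear_cmul[OF lin] h(3) p)
  ultimately show ?thesis
    by (simp add: inv_stereographic_conf_factor p)
qed

lemma inv_stereographic_in_polar_geodesic:
  assumes "norm w = 1"
  shows "inv_stereographic (\<rho> *\<^sub>R w) \<in> polar_geodesic w - {north_pole}"
proof -
  define p where "p = conf_factor (\<rho> *\<^sub>R w)"
  have "p * \<rho>\<^sup>2 = 2 - p"
    using conf_factor_times_norm_square[of "\<rho> *\<^sub>R w"] assms by (simp add: p_def power_mult_distrib)
  then have "(1 - p)\<^sup>2 + (p * \<rho>)\<^sup>2 = (1 - p)\<^sup>2 + p * (2 - p)"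
    by (metis mult.assoc mult.left_commute power2_eq_square)
  also have "\<dots> = 1" by (simp add: power2_eq_square algebra_simps)
  finally obtain t where "1 - p = cos t" "p * \<rho> = sin t"
    using sincos_total_2pi by blast
  then have "inv_stereographic (\<rho> *\<^sub>R w) = (sin t *\<^sub>R w, cos t)"
    by (simp add: inv_stereographic_conf_factor p_def)
  then show ?thesis
    using inv_stereographic_in[of "\<rho> *\<^sub>R w"] by (auto simp: polar_geodesic_def)
qed

text \<open>
  The two facts behind the comparison of the equation at \<open>y\<close> and at its image \<open>z\<close>: the image is
  nearer to the origin, and the inversion contracts the metric of the sphere, whose density is the
  conformal factor. Both follow from \<open>|z| |y - c| = r |y|\<close>, which holds because the sphere passes
  through the origin.
\<close>

lemma inversion_conformal_comparison:
  fixes y :: "'a::euclidean_space"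
  assumes e: "norm e = 1" and r: "r > 0" and out: "norm (y - r *\<^sub>R e) > r"
  defines "z \<equiv> sphere_inversion r (r *\<^sub>R e) y"
  shows "y \<noteq> 0" "z \<noteq> 0" "norm z < norm y"
    "inversion_factor r (r *\<^sub>R e) y * conf_factor z \<le> conf_factor y"
proof -
  define c d s where "c = r *\<^sub>R e" and "d = y - c" and "s = d \<bullet> d"
  have sn: "s = (norm d)\<^sup>2" by (simp add: s_def power2_norm_eq_inner)
  have nd: "norm d > r" using out by (simp add: d_def c_def)
  then have s: "s > r\<^sup>2" "s > 0" using r by (auto simp: sn intro!: power_strict_mono)
  show y0: "y \<noteq> 0" using out e r by auto
  have cc: "c \<bullet> c = r\<^sup>2" using e by (simp add: c_def norm_eq_1 power2_eq_square)
  have q: "inversion_factor r c y = r\<^sup>2 / s" by (simp add: inversion_factor_def s_def d_def)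
  have zz: "z \<bullet> z * s = r\<^sup>2 * (y \<bullet> y)"
  proof -
    have z: "z = c + (r\<^sup>2 / s) *\<^sub>R d" by (simp add: z_def sphere_inversion_def c_def[symmetric] q d_def)
    have "z \<bullet> z * s = (c \<bullet> c + 2 * (r\<^sup>2 / s) * (c \<bullet> d) + (r\<^sup>2 / s)\<^sup>2 * s) * s"
      unfolding z by (simp add: inner_add_left inner_add_right inner_commute s_def power2_eq_square algebra_simps)
    also have "\<dots> = r\<^sup>2 * (s + 2 * (c \<bullet> d) + r\<^sup>2)"
      using s by (simp add: cc field_simps power2_eq_square)
    also have "s + 2 * (c \<bullet> d) + r\<^sup>2 = y \<bullet> y"
      unfolding cc[symmetric] s_def d_def by (simp add: inner_diff_left inner_diff_right inner_commute)
    finally show ?thesis .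
  qed
  have yy: "y \<bullet> y > 0" using y0 by simp
  then have "z \<bullet> z * s > 0" using zz r by simp
  then show "z \<noteq> 0" by auto
  have "z \<bullet> z * s < (y \<bullet> y) * s" unfolding zz using s yy by (simp add: mult.commute)
  then have "z \<bullet> z < y \<bullet> y" using s by simp
  then show "norm z < norm y" by (simp add: norm_lt)
  have "r\<^sup>2 / s * (2 / ((norm z)\<^sup>2 + 1)) = 2 * r\<^sup>2 / (z \<bullet> z * s + s)"
    by (simp add: power2_norm_eq_inner algebra_simps)
  also have "\<dots> = 2 * r\<^sup>2 / (r\<^sup>2 * (y \<bullet> y) + s)" by (simp only: zz)
  also have "\<dots> \<le> 2 * r\<^sup>2 / (r\<^sup>2 * (y \<bullet> y) + r\<^sup>2)"
    using s r yy by (intro divide_left_mono mult_pos_pos add_pos_pos) auto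
  also have "\<dots> = 2 / (y \<bullet> y + 1)"
  proof -
    have "r\<^sup>2 * (y \<bullet> y) + r\<^sup>2 = r\<^sup>2 * (y \<bullet> y + 1)" by (simp add: algebra_simps)
    then show ?thesis using r by simp
  qed
  finally show "inversion_factor r (r *\<^sub>R e) y * conf_factor z \<le> conf_factor y"
    by (simp add: q[unfolded c_def] conf_factor_def power2_norm_eq_inner)
qed

text \<open>
  The lower limit at the pole controls a neighbourhood of infinity in the chart, and continuity
  the remaining compact ball.
\<close>

lemma bounded_below_of_Liminf_pos:
  fixes V :: "real ^ 'n \<Rightarrow> real"
  assumes V: "continuous_on UNIV V" and pos: "\<And>x. V x > 0"
    and Vv: "\<And>x. V x = v (inv_stereographic x)"
    and v: "Liminf (at north_pole within unit_sphere) (\<lambda>\<theta>. ereal (v \<theta>)) > 0"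
  shows "\<exists>k>0. \<forall>x. k \<le> V x"
proof -
  obtain l where l: "0 < l" "l < Liminf (at north_pole within unit_sphere) (\<lambda>\<theta>. ereal (v \<theta>))"
    using dense[OF v] by blast
  obtain m where m: "0 < m" "ereal m < l"
    using ereal_dense2[OF l(1)] by (metis ereal_less(2))
  then have "ereal m < Liminf (at north_pole within unit_sphere) (\<lambda>\<theta>. ereal (v \<theta>))"
    using l(2) by simp
  from less_LiminfD[OF this]
  have ev: "\<forall>\<^sub>F \<theta> in at north_pole within unit_sphere. v \<theta> > m" by simp
  have "filterlim (inv_stereographic :: real ^ 'n \<Rightarrow> _) (at north_pole within unit_sphere) at_infinity"
    unfolding filterlim_at using inv_stereographic_tendsto_north_pole inv_stereographic_in
    by (auto intro!: always_eventually)
  from filterlim_iff[THEN iffD1, rule_format, OF this ev]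
  have "\<forall>\<^sub>F x in at_infinity. V x > m" by (simp add: Vv)
  then obtain R where R: "\<And>x. norm x \<ge> R \<Longrightarrow> V x > m"
    unfolding eventually_at_infinity by blast
  have "continuous_on (cball 0 \<bar>R\<bar>) V" using V continuous_on_subset by blast
  then obtain x0 where x0: "\<And>x. x \<in> cball 0 \<bar>R\<bar> \<Longrightarrow> V x0 \<le> V x"
    using continuous_attains_inf[OF compact_cball] by (metis abs_ge_zero centre_in_cball empty_iff)
  have "min m (V x0) \<le> V x" for x
  proof (cases "norm x \<ge> R")
    case True
    then show ?thesis using R[of x] by simp
  next
    case False
    then have "norm x \<le> \<bar>R\<bar>" by simp
    then show ?thesis using x0[of x] by simp
  qed
  then show ?thesis using m(1) pos[of x0] by (intro exI[of _ "min m (V x0)"]) auto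
qed

theorem theorem1p4:
  fixes g :: "(real ^ 'n) \<times> real \<Rightarrow> real \<Rightarrow> real"
    and v :: "(real ^ 'n) \<times> real \<Rightarrow> real"
  assumes dim: "CARD('n) \<ge> 3"
    and g_cont: "continuous_on ((unit_sphere - {north_pole}) \<times> {0<..}) (\<lambda>(\<theta>, s). g \<theta> s)"
    and g_bdd_below: "\<And>s. s > 0 \<Longrightarrow> bdd_below ((\<lambda>\<theta>. g \<theta> s) ` (unit_sphere - {north_pole}))"
    and g_rot: "\<And>s. s > 0 \<Longrightarrow> rot_symmetric_on (unit_sphere - {north_pole}) (\<lambda>\<theta>. g \<theta> s)"
    and g_height: "\<And>s w \<theta> \<theta>'. s > 0 \<Longrightarrow> norm w = 1 \<Longrightarrow>
           \<theta> \<in> polar_geodesic w - {north_pole} \<Longrightarrow> \<theta>' \<in> polar_geodesic w - {north_pole} \<Longrightarrow>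
           snd \<theta> > snd \<theta>' \<Longrightarrow> g \<theta> s > g \<theta>' s"
    and g_noninc: "\<And>\<theta>. \<theta> \<in> unit_sphere - {north_pole, south_pole} \<Longrightarrow>
           antimono_on {0<..}
             (\<lambda>s. s powr (- ((real CARD('n) + 2) / (real CARD('n) - 2))) * g \<theta> s)"
    and g_nondec: "\<And>\<theta>. \<theta> \<in> unit_sphere - {north_pole, south_pole} \<Longrightarrow> mono_on {0<..} (g \<theta>)"
    and v_C2: "C2_punctured_sphere v"
    and v_eq: "\<And>\<theta>. \<theta> \<in> unit_sphere - {north_pole} \<Longrightarrow>
           - conformal_laplacian_sphere v \<theta> = g \<theta> (v \<theta>)"
    and v_pos: "\<And>\<theta>. \<theta> \<in> unit_sphere - {north_pole} \<Longrightarrow> v \<theta> > 0"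
    and v_liminf: "Liminf (at north_pole within unit_sphere) (\<lambda>\<theta>. ereal (v \<theta>)) > 0"
  shows "rot_symmetric_on (unit_sphere - {north_pole}) v"
proof -
  define a where "a = conformal_weight TYPE(real ^ 'n)"
  define V where "V = v \<circ> inv_stereographic"
  obtain G \<Delta> where lapV: "has_laplacian_on V G \<Delta> UNIV"
    using C2_on_imp_has_laplacian_on v_C2 unfolding C2_punctured_sphere_def V_def by blast
  have N: "real CARD('n) = 2 * a + 2"
    by (simp add: a_def conformal_weight_def field_simps)
  have a: "a > 0" using dim N by linarith
  have Vpos: "V x > 0" for x
    using v_pos[OF inv_stereographic_in, of x] by (simp add: V_def)
  define u where "u = (\<lambda>x. conf_factor x powr a * V x)"
  have upos: "u x > 0" for x using Vpos conf_factor_pos[of x] by (simp add: u_def)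
  have eq: "\<Delta> x / (conf_factor x)\<^sup>2 - 2 * a * (x \<bullet> G x) / conf_factor x - a * (a + 1) * V x
      = - g (inv_stereographic x) (V x)" for x
  proof -
    have "conformal_laplacian_sphere v (inv_stereographic x)
        = \<Delta> x / (conf_factor x)\<^sup>2 - (real CARD('n) - 2) * (x \<bullet> G x) / conf_factor x
          - real CARD('n) * (real CARD('n) - 2) / 4 * V x"
      using laplace_beltrami_stereographic[OF lapV, of x] dim
      by (simp add: conformal_laplacian_sphere_def laplacian_sphere_def stereographic_inv_stereographic V_def)
    also have "real CARD('n) * (real CARD('n) - 2) / 4 = a * (a + 1)"
      by (simp add: N field_simps)
    finally show ?thesis
      using v_eq[OF inv_stereographic_in, of x] by (simp add: N V_def)
  qed
  define D where "D = (\<lambda>x. conf_factor x powr (a + 2) * (- g (inv_stereographic x) (V x)))"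
  obtain Gu where lapu: "has_laplacian_on u Gu D UNIV"
    using has_laplacian_on_conformal_rescaling[OF lapV] unfolding a_def[symmetric] eq u_def D_def by blast
  have g_less: "g (inv_stereographic z) s < g (inv_stereographic y) s"
    if "norm z < norm y" "s > 0" for z y s
  proof -
    define w where "w = (1 / norm y) *\<^sub>R y"
    have y: "norm y > 0" using that(1) by (meson norm_ge_zero le_less_trans)
    have w: "norm w = 1" "y = norm y *\<^sub>R w" using y by (auto simp: w_def)
    \<comment> \<open>rotate \<open>z\<close> onto the ray of \<open>y\<close>, where the assumption on meridians applies\<close>
    have "g (inv_stereographic z) s = g (inv_stereographic (norm z *\<^sub>R w)) s"
      using dim w by (intro rot_symmetric_on_imp_eq[OF g_rot[OF that(2)]]) auto
    also have "\<dots> < g (inv_stereographic (norm y *\<^sub>R w)) s"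
    proof (rule g_height[OF that(2) w(1)])
      have "(norm z)\<^sup>2 < (norm y)\<^sup>2" using that by (intro power_strict_mono) auto
      then have "conf_factor (norm y *\<^sub>R w) < conf_factor (norm z *\<^sub>R w)"
        using w(1) by (simp add: conf_factor_def power_mult_distrib frac_less2 add_nonneg_pos)
      then show "snd (inv_stereographic (norm z *\<^sub>R w)) < snd (inv_stereographic (norm y *\<^sub>R w))"
        by (simp add: inv_stereographic_conf_factor)
    qed (intro inv_stereographic_in_polar_geodesic w)+
    finally show ?thesis using w(2) by simp
  qed
  have in2: "inv_stereographic x \<in> unit_sphere - {north_pole, south_pole}" if "x \<noteq> 0" for x :: "real ^ 'n"
    using inv_stereographic_in[of x] inv_stereographic_ne_south_pole[OF that] by simp
  have key: "D y < inversion_factor r (r *\<^sub>R e) y powr (a + 2) * D (sphere_inversion r (r *\<^sub>R e) y)"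
    if e: "norm e = 1" and r: "r > 0" and out: "norm (y - r *\<^sub>R e) > r" and le: "kelvin r (r *\<^sub>R e) u y \<le> u y"
    for e y :: "real ^ 'n" and r
  proof -
    define z q p p' \<alpha> where "z = sphere_inversion r (r *\<^sub>R e) y" and "q = inversion_factor r (r *\<^sub>R e) y"
      and "p = conf_factor y" and "p' = conf_factor z" and "\<alpha> = q * p'"
    have y0: "y \<noteq> 0" and z0: "z \<noteq> 0" and zy: "norm z < norm y" and \<alpha>p: "\<alpha> \<le> p"
      using inversion_conformal_comparison[OF e r out] by (auto simp: z_def q_def p_def p'_def \<alpha>_def)
    have "y \<noteq> r *\<^sub>R e" using out r by auto
    then have q: "q > 0" using inversion_factor_pos[OF r] by (simp add: q_def)
    have p: "p > 0" "p' > 0" by (simp_all add: p_def p'_def conf_factor_pos)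
    have \<alpha>: "\<alpha> > 0" using q p by (simp add: \<alpha>_def)
    define s where "s = kelvin r (r *\<^sub>R e) u y"
    have s: "s = q powr a * u z" by (simp add: s_def kelvin_def q_def z_def a_def)
    have s0: "s > 0" using q upos by (simp add: s)
    \<comment> \<open>in terms of \<open>v\<close>: the value \<open>t1\<close> of the Kelvin transform over \<open>y\<close>, and \<open>t2\<close> of \<open>v\<close>
        itself over \<open>z\<close>\<close>
    define t1 t2 where "t1 = p powr (- a) * s" and "t2 = \<alpha> powr (- a) * s"
    have t: "t1 > 0" "t2 > 0" using p \<alpha> s0 by (auto simp: t1_def t2_def)
    have "t1 \<le> t2"
      unfolding t1_def t2_def using \<alpha> \<alpha>p a s0 by (intro mult_right_mono powr_mono2') auto
    have Vz: "V z = t2"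
      using q p by (simp add: t2_def s u_def p'_def[symmetric] \<alpha>_def powr_mult powr_minus field_simps)
    have Vy: "t1 \<le> V y"
    proof -
      have "p powr (- a) * s \<le> p powr (- a) * u y"
        using le by (intro mult_left_mono) (auto simp: s_def)
      also have "\<dots> = V y" using p by (simp add: u_def p_def[symmetric] powr_minus field_simps)
      finally show ?thesis by (simp add: t1_def)
    qed
    define k where "k = (real CARD('n) + 2) / (real CARD('n) - 2)"
    have k: "a * k = a + 2" using a by (simp add: k_def N field_simps)
    have pw: "(b powr (- a) * s) powr (- k) = b powr (a + 2) * s powr (- k)" if "b > 0" for b
      using that s0 by (simp add: powr_mult powr_powr k add.commute)
    \<comment> \<open>the chain: from \<open>t2\<close> to \<open>t1\<close> by the growth bound on \<open>g\<close>, from \<open>z\<close> up to \<open>y\<close> by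
        monotonicity in height, and from \<open>t1\<close> to \<open>V y\<close> by monotonicity in the second variable\<close>
    have "t2 powr (- k) * g (inv_stereographic z) t2 \<le> t1 powr (- k) * g (inv_stereographic z) t1"
      using monotone_onD[OF g_noninc[OF in2[OF z0]], of t1 t2] t \<open>t1 \<le> t2\<close> by (simp add: k_def)
    then have "(\<alpha> powr (a + 2) * g (inv_stereographic z) t2) * s powr (- k) \<le> (p powr (a + 2) * g (inv_stereographic z) t1) * s powr (- k)"
      using pw[OF \<alpha>] pw[OF p(1)] by (simp add: t1_def t2_def mult_ac)
    then have "\<alpha> powr (a + 2) * g (inv_stereographic z) t2 \<le> p powr (a + 2) * g (inv_stereographic z) t1"
      using s0 by simp
    also have "\<dots> < p powr (a + 2) * g (inv_stereographic y) t1"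
      using g_less[OF zy t(1)] p by simp
    also have "\<dots> \<le> p powr (a + 2) * g (inv_stereographic y) (V y)"
      using monotone_onD[OF g_nondec[OF in2[OF y0]], of t1 "V y"] t Vy Vpos by (intro mult_left_mono) auto
    finally have "\<alpha> powr (a + 2) * g (inv_stereographic z) (V z) < p powr (a + 2) * g (inv_stereographic y) (V y)"
      by (simp add: Vz)
    then show ?thesis
      using q p by (simp add: D_def z_def[symmetric] q_def[symmetric] p_def[symmetric] p'_def[symmetric] \<alpha>_def powr_mult mult.assoc)
  qed
  have decay: "\<exists>k>0. \<forall>x. k * (1 + (norm x)\<^sup>2) powr (- a) \<le> u x"
  proof -
    have "continuous_on UNIV V"
      by (auto intro!: continuous_at_imp_continuous_on has_laplacian_on_imp_continuous(1)[OF lapV])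
    then obtain k where k: "k > 0" "\<And>x. k \<le> V x"
      using bounded_below_of_Liminf_pos[of V v] Vpos v_liminf by (auto simp: V_def)
    have "(2 powr a * k) * (1 + (norm x)\<^sup>2) powr (- a) \<le> u x" for x
    proof -
      have "1 + (norm x)\<^sup>2 > 0" by (simp add: add_pos_nonneg)
      then have "conf_factor x powr a = 2 powr a * (1 + (norm x)\<^sup>2) powr (- a)"
        by (simp add: conf_factor_def powr_divide powr_minus_divide add.commute)
      then show ?thesis
        using mult_left_mono[OF k(2)[of x], of "conf_factor x powr a"] by (simp add: u_def mult_ac)
    qed
    then show ?thesis using k(1) by (intro exI[of _ "2 powr a * k"]) auto
  qed
  interpret moving_spheres u Gu D a
    using dim lapu upos decay key by unfold_locales (auto simp: a_def)
  show ?thesis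
    unfolding rot_symmetric_on_def
  proof (intro allI impI)
    fix A :: "real ^ 'n ^ 'n" and y :: "real ^ 'n" and t
    assume A: "rotation_matrix A" and yt: "(y, t) \<in> unit_sphere - {north_pole}"
    have "orthogonal_transformation ((*v) A)"
      using A by (simp add: rotation_matrix_def orthogonal_transformation_matrix)
    then have nA: "norm (A *v y) = norm y"
      by (rule orthogonal_transformation_norm)
    have yt': "(A *v y, t) \<in> unit_sphere - {north_pole}"
      using yt nA by (auto simp: norm_Pair north_pole_def)
    define x x' where "x = stereographic (y, t)" and "x' = stereographic (A *v y, t)"
    have n: "norm x' = norm x"
      by (simp add: x_def x'_def stereographic_def nA)
    have "u x' = u x" by (rule radial[OF n])
    moreover have "conf_factor x' = conf_factor x" by (simp add: conf_factor_def n)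
    ultimately have "V x' = V x" using conf_factor_pos[of x] by (simp add: u_def)
    then show "v (A *v y, t) = v (y, t)"
      using inv_stereographic_stereographic[OF yt] inv_stereographic_stereographic[OF yt']
      by (simp add: V_def x_def x'_def)
  qed
qed

end
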